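(* Let $C: f=0$ be an arrangement of $d\geq 3$ lines in $\mathbb{P}^2$ (that is, $f\in S=\mathbb{C}[x,y,z]$ is a product of $d$ pairwise non-proportional linear forms), and assume that the $d$ lines do not all pass through one point. Then the graded $S$-module of Jacobian syzygies $$AR(f)=\{(a,b,c)\in S^3 \ : \ af_x+bf_y+cf_z=0\}$$ is generated by at most $d-1$ elements.
   Context: $S=\mathbb{C}[x,y,z]$ with the standard grading; $f_x,f_y,f_z$ are the partial derivatives of $f$. *)

theory Defs
  imports "HOL-Computational_Algebra.Computational_Algebra" "HOL-Library.Product_Plus"
begin

text \<open>
  The ring \<open>S = \<complex>[x,y,z]\<close> is represented as \<open>((\<complex>[x])[y])[z]\<close>: \<open>x\<close> is the innermost and \<open>z\<close>
  the outermost variable.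
\<close>

type_synonym cpoly3 = "complex poly poly poly"

definition coeff3 :: "cpoly3 \<Rightarrow> nat \<Rightarrow> nat \<Rightarrow> nat \<Rightarrow> complex"
  \<comment> \<open>the coefficient of \<open>x^i y^j z^k\<close>\<close>
  where "coeff3 p i j k = coeff (coeff (coeff p k) j) i"

definition eval3 :: "cpoly3 \<Rightarrow> complex \<times> complex \<times> complex \<Rightarrow> complex"
  where "eval3 p = (\<lambda>(u, v, w). poly (poly (poly p [:[:w:]:]) [:v:]) u)"

definition homogeneous :: "nat \<Rightarrow> cpoly3 \<Rightarrow> bool"
  where "homogeneous n p \<longleftrightarrow> (\<forall>i j k. coeff3 p i j k \<noteq> 0 \<longrightarrow> i + j + k = n)"

definition linear_form :: "cpoly3 \<Rightarrow> bool"
  \<comment> \<open>the zero form is excluded, so that \<open>l = 0\<close> is a line in the projective plane\<close>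
  where "linear_form l \<longleftrightarrow> l \<noteq> 0 \<and> homogeneous 1 l"

definition proportional :: "cpoly3 \<Rightarrow> cpoly3 \<Rightarrow> bool"
  where "proportional p q \<longleftrightarrow> (\<exists>c::complex. c \<noteq> 0 \<and> p = [:[:[:c:]:]:] * q)"

definition deriv_x :: "cpoly3 \<Rightarrow> cpoly3"
  where "deriv_x = map_poly (map_poly pderiv)"

definition deriv_y :: "cpoly3 \<Rightarrow> cpoly3"
  where "deriv_y = map_poly pderiv"

definition deriv_z :: "cpoly3 \<Rightarrow> cpoly3"
  where "deriv_z = pderiv"

lemma coeff3_deriv_x: "coeff3 (deriv_x p) i j k = of_nat (Suc i) * coeff3 p (Suc i) j k"
  by (simp add: coeff3_def deriv_x_def coeff_map_poly coeff_pderiv)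

lemma coeff3_deriv_y: "coeff3 (deriv_y p) i j k = of_nat (Suc j) * coeff3 p i (Suc j) k"
  by (simp add: coeff3_def deriv_y_def coeff_map_poly coeff_pderiv of_nat_poly
      flip: of_nat_Suc del: of_nat_Suc)

lemma coeff3_deriv_z: "coeff3 (deriv_z p) i j k = of_nat (Suc k) * coeff3 p i j (Suc k)"
  by (simp add: coeff3_def deriv_z_def coeff_map_poly coeff_pderiv of_nat_poly
      flip: of_nat_Suc del: of_nat_Suc)

definition scale3 :: "cpoly3 \<Rightarrow> cpoly3 \<times> cpoly3 \<times> cpoly3 \<Rightarrow> cpoly3 \<times> cpoly3 \<times> cpoly3"
  where "scale3 s = (\<lambda>(a, b, c). (s * a, s * b, s * c))"

global_interpretation S3: module scale3
  by unfold_locales (auto simp: scale3_def algebra_simps split: prod.splits)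

text \<open>
  Homogeneous elements of the graded free module \<open>S\<^sup>3\<close>: all three components have the same degree.
\<close>

definition homogeneous_triple :: "nat \<Rightarrow> cpoly3 \<times> cpoly3 \<times> cpoly3 \<Rightarrow> bool"
  where "homogeneous_triple n = (\<lambda>(a, b, c). homogeneous n a \<and> homogeneous n b \<and> homogeneous n c)"

definition AR :: "cpoly3 \<Rightarrow> (cpoly3 \<times> cpoly3 \<times> cpoly3) set"
  where "AR f = {(a, b, c). a * deriv_x f + b * deriv_y f + c * deriv_z f = 0}"

end

theory Submission imports Defs begin

text \<open>
  A syzygy \<open>\<theta>\<close> is a derivation killing \<open>f\<close>; since the \<open>l i\<close> are pairwise coprime, \<open>\<theta> (l i) = c\<^sub>i l i\<close> for
  all \<open>i\<close>. Choose three non-concurrent lines \<open>l 0\<close>, \<open>l 1\<close>, \<open>l 2\<close>. Modulo the Euler derivation, \<open>\<theta>\<close> is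
  determined by the pair \<open>(a, b) = (c\<^sub>1 - c\<^sub>0, c\<^sub>2 - c\<^sub>0)\<close>, which is subject to one divisibility condition
  for each of the other \<open>d - 3\<close> lines. These conditions force \<open>a b' - a' b\<close> to be divisible by the
  product \<open>H\<close> of those lines for any two such pairs, whereas \<open>(H, 0)\<close> and \<open>(0, H)\<close> satisfy them.
  Restrict the pairs to the line \<open>l 0 = 0\<close>. This gives a graded submodule \<open>N\<close> of \<open>\<complex>[x,y]\<^sup>2\<close> that
  contains \<open>h \<complex>[x,y]\<^sup>2\<close> and whose determinants are divisible by \<open>h\<close>, where \<open>h\<close> is the restriction of
  \<open>H\<close>, a product of \<open>d - 3\<close> linear forms.
  Removing the linear factors one by one shows that \<open>N\<close> is generated by \<open>d - 3\<close> elements modulo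
  \<open>h \<complex>[x,y]\<^sup>2\<close>, hence by \<open>d - 1\<close> elements, and by graded Nakayama they lift to generators of \<open>AR f\<close>.
\<close>

section \<open>Gradings\<close>

definition index_map :: "(nat \<Rightarrow> 'a \<Rightarrow> 'a) \<Rightarrow> 'a::comm_monoid_add poly \<Rightarrow> 'a poly"
  where "index_map F p = (\<Sum>k\<le>degree p. monom (F k (coeff p k)) k)"

lemma coeff_index_map:
  assumes "\<And>k. F k 0 = 0"
  shows "coeff (index_map F p) k = F k (coeff p k)"
  using assms by (simp add: index_map_def coeff_sum coeff_eq_0)

lemma coeff3_eqI: "(\<And>i j k. coeff3 p i j k = coeff3 q i j k) \<Longrightarrow> p = q"
  by (intro poly_eqI) (simp add: coeff3_def)

lemma coeff3_add [simp]: "coeff3 (p + q) i j k = coeff3 p i j k + coeff3 q i j k"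
  and coeff3_minus [simp]: "coeff3 (- p) i j k = - coeff3 p i j k"
  and coeff3_diff [simp]: "coeff3 (p - q) i j k = coeff3 p i j k - coeff3 q i j k"
  and coeff3_0 [simp]: "coeff3 0 i j k = 0"
  by (simp_all add: coeff3_def)

lemma coeff3_sum: "coeff3 (sum F A) i j k = (\<Sum>a\<in>A. coeff3 (F a) i j k)"
  by (induction A rule: infinite_finite_induct) simp_all

lemma coeff3_mult:
  "coeff3 (p * q) i j k =
     (\<Sum>c\<le>k. \<Sum>b\<le>j. \<Sum>a\<le>i. coeff3 p a b c * coeff3 q (i - a) (j - b) (k - c))"
  by (simp add: coeff3_def coeff_mult coeff_sum)

text \<open>Degrees are integers so that shifts such as \<open>k - 1\<close> never truncate; in
  negative degree only 0 is homogeneous.\<close>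

definition hom3 :: "int \<Rightarrow> cpoly3 \<Rightarrow> bool"
  where "hom3 n p \<longleftrightarrow> (\<forall>i j k. coeff3 p i j k \<noteq> 0 \<longrightarrow> int (i + j + k) = n)"

lemma homogeneous_iff_hom3: "homogeneous n p \<longleftrightarrow> hom3 (int n) p"
  unfolding homogeneous_def hom3_def by (simp only: of_nat_eq_iff)

lemma hom3_0 [simp]: "hom3 n 0"
  by (simp add: hom3_def)

lemma hom3_add: "hom3 n p \<Longrightarrow> hom3 n q \<Longrightarrow> hom3 n (p + q)"
  unfolding hom3_def by (metis add_0 coeff3_add)

lemma hom3_minus: "hom3 n p \<Longrightarrow> hom3 n (- p)"
  by (simp add: hom3_def)

lemma hom3_diff: "hom3 n p \<Longrightarrow> hom3 n q \<Longrightarrow> hom3 n (p - q)"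
  using hom3_add[of n p "- q"] hom3_minus[of n q] by simp

lemma hom3_sum: "(\<And>a. a \<in> A \<Longrightarrow> hom3 n (F a)) \<Longrightarrow> hom3 n (sum F A)"
  by (induction A rule: infinite_finite_induct) (simp_all add: hom3_add)

lemma hom3_mult:
  assumes "hom3 m p" "hom3 n q"
  shows "hom3 (m + n) (p * q)"
  unfolding hom3_def
proof (intro allI impI)
  fix i j k assume "coeff3 (p * q) i j k \<noteq> 0"
  then obtain a b c where abc: "a \<le> i" "b \<le> j" "c \<le> k"
    and "coeff3 p a b c * coeff3 q (i - a) (j - b) (k - c) \<noteq> 0"
    unfolding coeff3_mult by (meson atMost_iff sum.not_neutral_contains_not_neutral)
  then have "coeff3 p a b c \<noteq> 0" "coeff3 q (i - a) (j - b) (k - c) \<noteq> 0" by auto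
  then have "int (a + b + c) = m" "int ((i - a) + (j - b) + (k - c)) = n"
    using assms unfolding hom3_def by blast+
  then show "int (i + j + k) = m + n" using abc by linarith
qed

lemma hom3_const: "hom3 0 [:[:[:c:]:]:]"
  by (auto simp: hom3_def coeff3_def coeff_pCons split: nat.splits)

lemma hom3_cmult: "hom3 n p \<Longrightarrow> hom3 n ([:[:[:c:]:]:] * p)"
  using hom3_mult[OF hom3_const] by fastforce

section \<open>Homogeneous components\<close>

definition part3 :: "int \<Rightarrow> cpoly3 \<Rightarrow> cpoly3"
  where "part3 n = index_map (\<lambda>k. index_map (\<lambda>j. index_map (\<lambda>i c. if int (i + j + k) = n then c else 0)))"

lemma coeff3_part3: "coeff3 (part3 n p) i j k = (if int (i + j + k) = n then coeff3 p i j k else 0)"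
proof -
  have [simp]: "index_map F 0 = 0" if "\<And>k. F k 0 = 0" for F :: "nat \<Rightarrow> 'b::comm_monoid_add \<Rightarrow> 'b"
    using that by (simp add: index_map_def)
  show ?thesis by (simp add: coeff3_def part3_def coeff_index_map)
qed

lemma hom3_part3: "hom3 n (part3 n p)"
  by (simp add: hom3_def coeff3_part3)

lemma part3_add: "part3 n (p + q) = part3 n p + part3 n q"
  by (rule coeff3_eqI) (simp add: coeff3_part3)

lemma part3_0 [simp]: "part3 n 0 = 0"
  by (rule coeff3_eqI) (simp add: coeff3_part3)

lemma part3_sum: "part3 n (sum F A) = (\<Sum>a\<in>A. part3 n (F a))"
  by (induction A rule: infinite_finite_induct) (simp_all add: part3_add)

lemma part3_hom3: "hom3 m p \<Longrightarrow> part3 n p = (if n = m then p else 0)"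
  by (rule coeff3_eqI) (auto simp add: coeff3_part3 hom3_def)

text \<open>Every large enough bound works, so that bounds for several polynomials can be
  combined.\<close>

lemma sum_part3: "\<exists>n. \<forall>m\<ge>n. p = (\<Sum>r\<le>m. part3 (int r) p)"
proof -
  \<comment> \<open>All exponents lie in the box with sides \<open>a\<close>, \<open>c\<close>,
    \<open>b\<close>; sums of degrees serve as crude bounds for maxima.\<close>
  define b where "b = degree p"
  define c where "c = (\<Sum>k\<le>b. degree (coeff p k))"
  define a where "a = (\<Sum>k\<le>b. \<Sum>j\<le>c. degree (coeff (coeff p k) j))"
  have bd: "i \<le> a \<and> j \<le> c \<and> k \<le> b" if nz: "coeff3 p i j k \<noteq> 0" for i j k
  proof -
    have k: "k \<le> b"
      unfolding b_def by (rule le_degree) (use nz in \<open>auto simp: coeff3_def\<close>)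
    have "j \<le> degree (coeff p k)"
      by (rule le_degree) (use nz in \<open>auto simp: coeff3_def\<close>)
    also have "\<dots> \<le> c"
      unfolding c_def using k by (intro member_le_sum) auto
    finally have j: "j \<le> c" .
    have "i \<le> degree (coeff (coeff p k) j)"
      by (rule le_degree) (use nz in \<open>auto simp: coeff3_def\<close>)
    also have "\<dots> \<le> (\<Sum>j\<le>c. degree (coeff (coeff p k) j))"
      using j by (intro member_le_sum) auto
    also have "\<dots> \<le> a"
      unfolding a_def using k by (intro member_le_sum) auto
    finally show ?thesis using j k by simp
  qed
  have "p = (\<Sum>r\<le>m. part3 (int r) p)" if m: "m \<ge> a + b + c" for m
  proof (rule coeff3_eqI)
    fix i j k
    have "coeff3 p i j k = 0" if "i + j + k > m"
      using bd[of i j k] that m by linarith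
    then show "coeff3 p i j k = coeff3 (\<Sum>r\<le>m. part3 (int r) p) i j k"
      by (auto simp: coeff3_sum coeff3_part3 simp del: of_nat_add)
  qed
  then show ?thesis by blast
qed

lemma part3_mult_hom3:
  assumes "hom3 m g"
  shows "part3 (n + m) (p * g) = part3 n p * g"
proof -
  obtain b where b: "\<And>m. m \<ge> b \<Longrightarrow> p = (\<Sum>r\<le>m. part3 (int r) p)"
    using sum_part3 by blast
  define B where "B = max b (nat n)"
  have p: "p = (\<Sum>r\<le>B. part3 (int r) p)" using b[of B] by (simp add: B_def)
  have "part3 (n + m) (p * g) = (\<Sum>r\<le>B. part3 (n + m) (part3 (int r) p * g))"
    by (subst p) (simp add: sum_distrib_right part3_sum)
  also have "\<dots> = (\<Sum>r\<le>B. if n = int r then part3 n p * g else 0)"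
    by (intro sum.cong refl) (auto simp: part3_hom3[OF hom3_mult[OF hom3_part3 assms]])
  also have "\<dots> = (\<Sum>r\<le>B. part3 n (part3 (int r) p) * g)"
    by (intro sum.cong refl) (auto simp: part3_hom3[OF hom3_part3])
  also have "\<dots> = part3 n (\<Sum>r\<le>B. part3 (int r) p) * g"
    by (simp add: sum_distrib_right part3_sum)
  finally show ?thesis using p by simp
qed

text \<open>Taking the component of degree \<open>n + m\<close> leaves \<open>p * g\<close>
  unchanged and replaces \<open>p\<close> by its component of degree \<open>n\<close>; then
  \<open>g\<close> cancels.\<close>

lemma hom3_cancel:
  assumes "hom3 (n + m) (p * g)" "hom3 m g" "g \<noteq> 0"
  shows "hom3 n p"
proof -
  have "part3 n p * g = p * g"
    using part3_hom3[OF assms(1), of "n + m"] part3_mult_hom3[OF assms(2), of n p] by simp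
  then show ?thesis using \<open>g \<noteq> 0\<close> hom3_part3[of n p] by simp
qed

section \<open>Binary forms in x and y\<close>

definition hom2 :: "int \<Rightarrow> complex poly poly \<Rightarrow> bool"
  where "hom2 n p \<longleftrightarrow> hom3 n [:p:]"

lemma hom2_iff: "hom2 n p \<longleftrightarrow> (\<forall>i j. coeff (coeff p j) i \<noteq> 0 \<longrightarrow> int (i + j) = n)"
  by (auto simp: hom2_def hom3_def coeff3_def coeff_pCons split: nat.splits)

lemma hom2_0 [simp]: "hom2 n 0"
  by (simp add: hom2_def)

lemma hom2_add: "hom2 n p \<Longrightarrow> hom2 n q \<Longrightarrow> hom2 n (p + q)"
  using hom3_add[of n "[:p:]" "[:q:]"] by (simp add: hom2_def)

lemma hom2_diff: "hom2 n p \<Longrightarrow> hom2 n q \<Longrightarrow> hom2 n (p - q)"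
  using hom3_diff[of n "[:p:]" "[:q:]"] by (simp add: hom2_def)

lemma hom2_mult: "hom2 m p \<Longrightarrow> hom2 n q \<Longrightarrow> hom2 (m + n) (p * q)"
  using hom3_mult[of m "[:p:]" n "[:q:]"] by (simp add: hom2_def mult.commute)

lemma hom2_const: "hom2 0 [:[:c:]:]"
  by (simp add: hom2_def hom3_const)

lemma hom2_power: "hom2 m p \<Longrightarrow> hom2 (m * int n) (p ^ n)"
proof (induction n)
  case 0
  show ?case using hom2_const[of 1] by (simp add: one_pCons)
next
  case (Suc n)
  then show ?case using hom2_mult[of m p "m * int n" "p ^ n"] by (simp add: algebra_simps)
qed

lemma hom2_sum: "(\<And>a. a \<in> A \<Longrightarrow> hom2 n (F a)) \<Longrightarrow> hom2 n (sum F A)"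
  by (induction A rule: infinite_finite_induct) (simp_all add: hom2_add)

lemma hom2_cancel: "hom2 (n + m) (p * g) \<Longrightarrow> hom2 m g \<Longrightarrow> g \<noteq> 0 \<Longrightarrow> hom2 n p"
  using hom3_cancel[of n m "[:p:]" "[:g:]"] by (simp add: hom2_def mult.commute)

text \<open>The coefficient of z^k has degree \<open>n - k\<close>, and the factor
  \<open>q ^ k\<close> restores the missing \<open>k\<close>.\<close>

lemma hom2_poly:
  assumes "hom3 n p" "hom2 1 q"
  shows "hom2 n (poly p q)"
  unfolding poly_altdef
proof (intro hom2_sum)
  fix k
  have "hom2 (n - int k) (coeff p k)"
    using assms(1) unfolding hom2_iff hom3_def coeff3_def by fastforce
  from hom2_mult[OF this hom2_power[OF assms(2), of k]]
  show "hom2 n (coeff p k * q ^ k)" by simp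
qed

lemma hom2_1_eq:
  assumes "hom2 1 h"
  shows "h = [:[:0, coeff (coeff h 0) 1:], [:coeff (coeff h 1) 0:]:]"
proof (intro poly_eqI)
  fix j i
  have "coeff (coeff h j) i = 0" if "i + j \<noteq> 1"
    using assms that unfolding hom2_iff by (metis of_nat_1 of_nat_eq_iff)
  then show "coeff (coeff h j) i
      = coeff (coeff [:[:0, coeff (coeff h 0) 1:], [:coeff (coeff h 1) 0:]:] j) i"
    by (auto simp: coeff_pCons split: nat.splits)
qed

text \<open>Spreads a single zero of a binary form along its line through the origin. If
  \<open>n < 0\<close> then \<open>p = 0\<close>, so the truncation in \<open>nat n\<close> does no
  harm.\<close>

lemma hom2_eval_scale:
  assumes "hom2 n p"
  shows "poly (poly p [:s * v:]) (s * u) = s ^ nat n * poly (poly p [:v:]) u"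
proof -
  have *: "poly (poly p [:v:]) u = (\<Sum>j\<le>degree p. \<Sum>i\<le>degree (coeff p j). coeff (coeff p j) i * u ^ i * v ^ j)"
    for u v
    by (simp add: poly_altdef[of p] poly_sum poly_altdef[of "coeff p _"] sum_distrib_right)
  show ?thesis
    unfolding * sum_distrib_left
  proof (intro sum.cong refl)
    fix i j
    show "coeff (coeff p j) i * (s * u) ^ i * (s * v) ^ j = s ^ nat n * (coeff (coeff p j) i * u ^ i * v ^ j)"
    proof (cases "coeff (coeff p j) i = 0")
      case False
      then have "int (i + j) = n" using assms by (simp add: hom2_iff)
      then have "nat n = i + j" by linarith
      then show ?thesis by (simp add: power_mult_distrib power_add)
    qed simp
  qed
qed

text \<open>The form \<alpha> x + \<beta> y vanishes at x = \<beta>, y = -\<alpha>, and a form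
  \<open>p\<close> vanishing there vanishes on the whole line. If \<beta> is nonzero, the factor
  theorem in y applies; otherwise \<open>h\<close> is a constant times x, and divisibility is
  checked on each coefficient in y.\<close>

lemma linear_dvd_of_root:
  assumes h: "hom2 1 h" and nz: "h \<noteq> 0" and p: "hom2 n p"
    and root: "poly (poly p [:- coeff (coeff h 0) 1:]) (coeff (coeff h 1) 0) = 0"
  shows "h dvd p"
proof -
  define \<alpha> \<beta> where "\<alpha> = coeff (coeff h 0) 1" and "\<beta> = coeff (coeff h 1) 0"
  have h_eq: "h = [:[:0, \<alpha>:], [:\<beta>:]:]"
    using hom2_1_eq[OF h] by (simp add: \<alpha>_def \<beta>_def)
  have rt: "poly (poly p [:s * - \<alpha>:]) (s * \<beta>) = 0" for s
    using hom2_eval_scale[OF p, of s "- \<alpha>" \<beta>] root by (simp add: \<alpha>_def \<beta>_def)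
  show ?thesis
  proof (cases "\<beta> = 0")
    case False
    define q where "q = poly p [:0, - \<alpha> / \<beta>:]"
    have "poly q t = 0" for t
    proof -
      have "poly q t = poly (poly p [:t * - \<alpha> / \<beta>:]) t"
        unfolding q_def by (induction p) (simp_all)
      then show ?thesis using rt[of "t / \<beta>"] False by simp
    qed
    then have "q = 0" using poly_all_0_iff_0 by blast
    then have "[:- [:0, - \<alpha> / \<beta>:], 1:] dvd p"
      unfolding q_def by (simp only: poly_eq_0_iff_dvd)
    moreover have "h = [:[:\<beta>:]:] * [:- [:0, - \<alpha> / \<beta>:], 1:]"
      using False by (simp add: h_eq)
    moreover have "[:[:\<beta>:]:] dvd 1"
      using False by (intro dvdI[of _ _ "[:[:1 / \<beta>:]:]"]) (simp add: one_pCons)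
    ultimately show ?thesis by (metis mult_unit_dvd_iff')
  next
    case True
    then have "\<alpha> \<noteq> 0" using nz h_eq by auto
    have "[:0, \<alpha>:] dvd coeff p j" for j
    proof -
      have "coeff (coeff p j) 0 = 0"
      proof (rule ccontr)
        assume c: "coeff (coeff p j) 0 \<noteq> 0"
        then have n: "n = int j" using p unfolding hom2_iff by fastforce
        have 1: "coeff (coeff p j') 0 = 0" if "j' \<noteq> j" for j'
          using p that n unfolding hom2_iff by fastforce
        \<comment> \<open>Scaling by \<open>- 1 / \<alpha>\<close> moves the root to x = 0, y = 1,
          where only pure powers of y survive; by homogeneity the power \<open>j\<close> is the only
          one.\<close>
        have "0 = (\<Sum>i\<le>degree p. coeff (coeff p i) 0 * 1)"
          using rt[of "- 1 / \<alpha>"] True \<open>\<alpha> \<noteq> 0\<close>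
          by (simp add: poly_altdef[of p] poly_0_coeff_0 coeff_sum flip: one_pCons)
        also have "\<dots> = (\<Sum>i\<le>degree p. if i = j then coeff (coeff p j) 0 else 0)"
          by (intro sum.cong refl) (auto simp: 1)
        also have "\<dots> = coeff (coeff p j) 0"
          using c le_degree[of p j] by (cases "coeff p j = 0") auto
        finally show False using c by simp
      qed
      then have "[:0, 1:] dvd coeff p j"
        using poly_eq_0_iff_dvd[of "coeff p j" 0] by (simp add: poly_0_coeff_0)
      moreover have "[:0, \<alpha>:] = [:\<alpha>:] * [:0, 1:]" by simp
      moreover have "[:\<alpha>:] dvd 1"
        using \<open>\<alpha> \<noteq> 0\<close> by (intro dvdI[of _ _ "[:1 / \<alpha>:]"]) (simp add: one_pCons)
      ultimately show ?thesis by (metis mult_unit_dvd_iff')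
    qed
    then show ?thesis using True by (simp add: h_eq const_poly_dvd_iff)
  qed
qed

section \<open>Graded modules over binary forms\<close>

text \<open>\<open>ev\<close> is evaluation at a representative of the projective zero of the binary linear form \<open>h\<close>,
  and the linear form \<open>t\<close> normalises that representative.\<close>

definition zero_of :: "complex poly poly \<Rightarrow> (complex poly poly \<Rightarrow> complex) \<Rightarrow> complex poly poly \<Rightarrow> bool"
  where "zero_of h ev t \<longleftrightarrow>
    (\<forall>p q. ev (p + q) = ev p + ev q) \<and> (\<forall>p q. ev (p - q) = ev p - ev q) \<and>
    (\<forall>p q. ev (p * q) = ev p * ev q) \<and> (\<forall>c. ev [:[:c:]:] = c) \<and> (\<forall>p n. ev (p ^ n) = ev p ^ n) \<and>
    hom2 1 t \<and> ev t = 1 \<and> ev h = 0 \<and> (\<forall>n p. hom2 n p \<longrightarrow> ev p = 0 \<longrightarrow> h dvd p)"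

lemma ex_zero_of:
  assumes h: "hom2 1 h" "h \<noteq> 0"
  shows "\<exists>ev t. zero_of h ev t"
proof -
  define \<alpha> \<beta> where "\<alpha> = coeff (coeff h 0) 1" and "\<beta> = coeff (coeff h 1) 0"
  define ev where "ev p = poly (poly p [:- \<alpha>:]) \<beta>" for p
  have h_eq: "h = [:[:0, \<alpha>:], [:\<beta>:]:]"
    using hom2_1_eq[OF h(1)] by (simp add: \<alpha>_def \<beta>_def)
  define t where "t = (if \<beta> \<noteq> 0 then [:[:0, 1 / \<beta>:]:] else [:0, [:- 1 / \<alpha>:]:])"
  have t: "hom2 1 t"
    by (auto simp: t_def hom2_iff coeff_pCons split: nat.splits)
  have evt: "ev t = 1"
    using h(2) by (auto simp: t_def ev_def h_eq)
  have dvd: "h dvd p" if "hom2 n p" "ev p = 0" for n p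
    using linear_dvd_of_root[OF h that(1)] that(2) by (simp add: ev_def \<alpha>_def \<beta>_def)
  have "ev h = 0" by (simp add: ev_def h_eq)
  then have "zero_of h ev t"
    unfolding zero_of_def using t evt dvd by (simp add: ev_def)
  then show ?thesis by blast
qed

section \<open>Graded submodules of a free module of rank two\<close>

definition gsub :: "(int \<Rightarrow> (complex poly poly \<times> complex poly poly) set) \<Rightarrow> bool"
  where "gsub N \<longleftrightarrow> (\<forall>k x y. x \<in> N k \<longrightarrow> y \<in> N k \<longrightarrow> x + y \<in> N k) \<and>
    (\<forall>k m r x. x \<in> N k \<longrightarrow> hom2 m r \<longrightarrow> (r * fst x, r * snd x) \<in> N (k + m))"

lemma gsub_add: "gsub N \<Longrightarrow> x \<in> N k \<Longrightarrow> y \<in> N k \<Longrightarrow> x + y \<in> N k"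
  unfolding gsub_def by blast

lemma gsub_mult: "gsub N \<Longrightarrow> (a, b) \<in> N k \<Longrightarrow> hom2 m r \<Longrightarrow> (r * a, r * b) \<in> N (k + m)"
  unfolding gsub_def by fastforce

lemma gsub_diff:
  assumes "gsub N" "x \<in> N k" "y \<in> N k"
  shows "x - y \<in> N k"
proof -
  have "hom2 0 (- 1)" using hom2_const[of "- 1"] by (simp add: one_pCons)
  then have "(- fst y, - snd y) \<in> N k"
    using gsub_mult[OF assms(1), of "fst y" "snd y" k 0 "- 1"] assms(3) by simp
  from gsub_add[OF assms(1,2) this] show ?thesis by (cases x; cases y) simp
qed

lemma gsub_swap:
  assumes "gsub N"
  shows "gsub (\<lambda>k. prod.swap ` N k)"
  unfolding gsub_def
proof (intro conjI allI impI)
  fix k x y assume "x \<in> prod.swap ` N k" "y \<in> prod.swap ` N k"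
  then have "prod.swap x \<in> N k" "prod.swap y \<in> N k" by auto
  from gsub_add[OF assms this] show "x + y \<in> prod.swap ` N k"
    by (cases x; cases y) force
next
  fix k n r x assume "x \<in> prod.swap ` N k" and r: "hom2 n r"
  then have "(snd x, fst x) \<in> N k" by auto
  from gsub_mult[OF assms this r] show "(r * fst x, r * snd x) \<in> prod.swap ` N (k + n)"
    by force
qed

text \<open>
  \<open>N\<close> is a graded submodule of \<open>\<complex>[x,y](\<alpha>) \<oplus> \<complex>[x,y](\<beta>)\<close>, given by its homogeneous components, and
  \<open>m\<close> is the degree of \<open>h\<close>. The property says that \<open>G\<close> generates \<open>N\<close> modulo the multiples of \<open>h\<close>;
  it is phrased as an induction principle over graded submodules \<open>W\<close>, which avoids explicit
  linear combinations.
\<close>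

definition generates_mod ::
  "nat \<Rightarrow> int \<Rightarrow> int \<Rightarrow> complex poly poly \<Rightarrow> (int \<Rightarrow> (complex poly poly \<times> complex poly poly) set)
    \<Rightarrow> (int \<times> complex poly poly \<times> complex poly poly) set \<Rightarrow> bool"
  where "generates_mod m \<alpha> \<beta> h N G \<longleftrightarrow>
    finite G \<and> card G \<le> m \<and> (\<forall>k x. (k, x) \<in> G \<longrightarrow> x \<in> N k) \<and>
    (\<forall>W. gsub W \<longrightarrow> (\<forall>k x. (k, x) \<in> G \<longrightarrow> x \<in> W k) \<longrightarrow>
      (\<forall>k p q. (h * p, h * q) \<in> N k \<longrightarrow> hom2 (k + \<alpha> - int m) p \<longrightarrow> hom2 (k + \<beta> - int m) q
        \<longrightarrow> (h * p, h * q) \<in> W k) \<longrightarrow>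
      (\<forall>k. N k \<subseteq> W k))"

lemma generates_modD:
  assumes "generates_mod m \<alpha> \<beta> h N G"
  shows "finite G" "card G \<le> m" "(k, x) \<in> G \<Longrightarrow> x \<in> N k"
  using assms unfolding generates_mod_def by blast+

lemma generates_mod_subset:
  assumes "generates_mod m \<alpha> \<beta> h N G" "gsub W" "\<And>k x. (k, x) \<in> G \<Longrightarrow> x \<in> W k"
    and "\<And>k p q. (h * p, h * q) \<in> N k \<Longrightarrow> hom2 (k + \<alpha> - int m) p \<Longrightarrow> hom2 (k + \<beta> - int m) q
        \<Longrightarrow> (h * p, h * q) \<in> W k"
  shows "N k \<subseteq> W k"
  using assms(1)[unfolded generates_mod_def, THEN conjunct2, THEN conjunct2, THEN conjunct2,
      rule_format, OF assms(2-4)] .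

lemma generates_modI:
  assumes "finite G" "card G \<le> m" "\<And>k x. (k, x) \<in> G \<Longrightarrow> x \<in> N k"
    and "\<And>W k. gsub W \<Longrightarrow> (\<And>k x. (k, x) \<in> G \<Longrightarrow> x \<in> W k) \<Longrightarrow>
      (\<And>k p q. (h * p, h * q) \<in> N k \<Longrightarrow> hom2 (k + \<alpha> - int m) p \<Longrightarrow> hom2 (k + \<beta> - int m) q
        \<Longrightarrow> (h * p, h * q) \<in> W k) \<Longrightarrow> N k \<subseteq> W k"
  shows "generates_mod m \<alpha> \<beta> h N G"
  unfolding generates_mod_def
proof (intro conjI allI impI)
  fix W k
  assume "gsub W" "\<forall>k x. (k, x) \<in> G \<longrightarrow> x \<in> W k"
    "\<forall>k p q. (h * p, h * q) \<in> N k \<longrightarrow> hom2 (k + \<alpha> - int m) p \<longrightarrow> hom2 (k + \<beta> - int m) q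
        \<longrightarrow> (h * p, h * q) \<in> W k"
  then show "N k \<subseteq> W k" by (intro assms(4)) blast+
qed (use assms(1-3) in simp_all)

text \<open>Exchanging the coordinates exchanges the shifts, so that later arguments may assume
  \<open>\<beta> \<le> \<alpha>\<close>.\<close>

lemma generates_mod_swap:
  assumes "\<exists>G. generates_mod m \<beta> \<alpha> h (\<lambda>k. prod.swap ` N k) G"
  shows "\<exists>G. generates_mod m \<alpha> \<beta> h N G"
proof -
  obtain G where gen: "generates_mod m \<beta> \<alpha> h (\<lambda>k. prod.swap ` N k) G"
    using assms by blast
  note G = generates_modD[OF gen]
  have sub: "N k \<subseteq> W' k"
    if W': "gsub W'" "\<And>k x. (k, x) \<in> map_prod id prod.swap ` G \<Longrightarrow> x \<in> W' k"
      "\<And>k p q. (h * p, h * q) \<in> N k \<Longrightarrow> hom2 (k + \<alpha> - int m) p \<Longrightarrow> hom2 (k + \<beta> - int m) q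
          \<Longrightarrow> (h * p, h * q) \<in> W' k" for W' k
  proof -
    have "prod.swap ` N k \<subseteq> prod.swap ` W' k" for k
    proof (rule generates_mod_subset[OF gen])
      show "gsub (\<lambda>k. prod.swap ` W' k)"
        by (rule gsub_swap[OF W'(1)])
    next
      fix k x assume "(k, x) \<in> G"
      then show "x \<in> prod.swap ` W' k" using W'(2) by (cases x) force
    next
      fix k p q assume "(h * p, h * q) \<in> prod.swap ` N k"
        "hom2 (k + \<beta> - int m) p" "hom2 (k + \<alpha> - int m) q"
      then have "(h * q, h * p) \<in> W' k" using W'(3) by auto
      then show "(h * p, h * q) \<in> prod.swap ` W' k" by force
    qed
    from this[of k] show ?thesis by (force simp: image_iff)
  qed
  have fin: "finite (map_prod id prod.swap ` G)" and card: "card (map_prod id prod.swap ` G) \<le> m"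
    using G(1,2) card_image_le[OF G(1)] le_trans by blast+
  have mem: "x \<in> N k" if "(k, x) \<in> map_prod id prod.swap ` G" for k x
    using G(3) that by force
  show ?thesis
  proof (rule exI, rule generates_modI[OF fin card mem])
    fix W k
    assume "gsub W" "\<And>k x. (k, x) \<in> map_prod id prod.swap ` G \<Longrightarrow> x \<in> W k"
      "\<And>k p q. (h * p, h * q) \<in> N k \<Longrightarrow> hom2 (k + \<alpha> - int m) p \<Longrightarrow> hom2 (k + \<beta> - int m) q
          \<Longrightarrow> (h * p, h * q) \<in> W k"
    then show "N k \<subseteq> W k" by (rule sub)
  qed
qed

text \<open>
  After the change of coordinates \<open>a = \<delta> b + h1 a'\<close>, passing from multiples of \<open>h'\<close> to multiples of
  \<open>h1 h'\<close> costs one generator: the quotient is a graded submodule of \<open>\<complex>[x,y]/h1\<close>, a polynomial ring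
  in one variable, so it is generated by an element of least degree.
\<close>

lemma generates_mod_step:
  fixes \<alpha> \<beta> :: int
  assumes N: "gsub N"
    and h1: "hom2 1 h1" "h1 \<noteq> 0" and h': "hom2 (int m) h'" "h' \<noteq> 0"
    and \<delta>: "hom2 (\<alpha> - \<beta>) \<delta>"
    and red: "\<And>k a b. (a, b) \<in> N k \<Longrightarrow> h1 dvd a - \<delta> * b"
    and IH: "\<exists>G. generates_mod m (\<alpha> - 1) \<beta> h'
      (\<lambda>k. {x. (case x of (a, b) \<Rightarrow> (\<delta> * b + h1 * a, b)) \<in> N k}) G"
  shows "\<exists>G. generates_mod (Suc m) \<alpha> \<beta> (h1 * h') N G"
proof -
  define \<psi> where "\<psi> = (\<lambda>(a, b). (\<delta> * b + h1 * a, b))"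
  have \<psi>: "\<psi> (a, b) = (\<delta> * b + h1 * a, b)" for a b by (simp add: \<psi>_def)
  obtain G where gen: "generates_mod m (\<alpha> - 1) \<beta> h' (\<lambda>k. {x. \<psi> x \<in> N k}) G"
    using IH unfolding \<psi>_def by blast
  note G = generates_modD[OF gen]
  obtain ev t where z: "zero_of h1 ev t" using ex_zero_of[OF h1] by blast
  then have ev: "ev (p + q) = ev p + ev q" "ev (p - q) = ev p - ev q"
    "ev (p * q) = ev p * ev q" "ev [:[:c:]:] = c" "ev (p ^ n) = ev p ^ n" for p q c n
    by (simp_all add: zero_of_def)
  have t: "hom2 1 t" "ev t = 1" and ev_h1: "ev h1 = 0"
    and dvd: "\<And>n p. hom2 n p \<Longrightarrow> ev p = 0 \<Longrightarrow> h1 dvd p"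
    using z by (auto simp: zero_of_def)
  \<comment> \<open>What the generators \<open>G\<close> leave open: multiples of \<open>h'\<close>
    in the new coordinates, with cofactors of the expected degrees.\<close>
  define Q where "Q = (\<lambda>(k, p, q). \<psi> (h' * p, h' * q) \<in> N k \<and> hom2 (k + \<alpha> - 1 - int m) p \<and>
      hom2 (k + \<beta> - int m) q)"
  \<comment> \<open>One element is enough: the obstruction is the value of \<open>q\<close> at the
    zero of \<open>h1\<close>, and a multiple of an element of least degree cancels it.\<close>
  obtain G0 where G0: "finite G0" "card G0 \<le> 1" "\<And>k x. (k, x) \<in> G0 \<Longrightarrow> x \<in> N k"
    and reduce: "\<And>k p q. Q (k, p, q) \<Longrightarrow> ev q = 0 \<or>
       (\<exists>k0 p0 q0 s. (k0, \<psi> (h' * p0, h' * q0)) \<in> G0 \<and> Q (k0, p0, q0) \<and> hom2 (k - k0) s \<and> ev (q - s * q0) = 0)"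
  proof (cases "\<exists>x. Q x \<and> ev (snd (snd x)) \<noteq> 0")
    case False
    then show thesis by (intro that[of "{}"]) auto
  next
    case True
    then obtain x0 where "Q x0 \<and> ev (snd (snd x0)) \<noteq> 0"
      and min: "\<And>x. Q x \<and> ev (snd (snd x)) \<noteq> 0 \<Longrightarrow>
          nat (fst x0 + \<beta> - int m) \<le> nat (fst x + \<beta> - int m)"
      using ex_has_least_nat[of "\<lambda>x. Q x \<and> ev (snd (snd x)) \<noteq> 0" _ "\<lambda>x. nat (fst x + \<beta> - int m)"]
      by blast
    then obtain k0 p0 q0 where Q0: "Q (k0, p0, q0)" "ev q0 \<noteq> 0" and x0: "x0 = (k0, p0, q0)"
      by (cases x0) auto
    \<comment> \<open>Ensures that \<open>nat\<close> in the minimality condition compares the true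
      degrees, whence \<open>k0 \<le> k\<close>.\<close>
    have nonneg: "n \<ge> 0" if "hom2 n q" "ev q \<noteq> 0" for n q
    proof -
      have "ev 0 = 0" using ev(4)[of 0] by simp
      then have "q \<noteq> 0" using that by auto
      then obtain j i where "coeff (coeff q j) i \<noteq> 0" by (metis leading_coeff_0_iff)
      then show ?thesis using that(1) unfolding hom2_iff by force
    qed
    show thesis
    proof (rule that[of "{(k0, \<psi> (h' * p0, h' * q0))}"])
      fix k p q assume Q: "Q (k, p, q)"
      show "ev q = 0 \<or>
       (\<exists>k0' p0' q0' s. (k0', \<psi> (h' * p0', h' * q0')) \<in> {(k0, \<psi> (h' * p0, h' * q0))} \<and>
          Q (k0', p0', q0') \<and> hom2 (k - k0') s \<and> ev (q - s * q0') = 0)"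
      proof (cases "ev q = 0")
        case False
        have "k0 + \<beta> - int m \<ge> 0" "k + \<beta> - int m \<ge> 0"
          using nonneg Q0 Q False unfolding Q_def by blast+
        then have le: "k0 \<le> k" using min[of "(k, p, q)"] Q False x0 by simp
        \<comment> \<open>Since \<open>t\<close> has value 1 at the zero of \<open>h1\<close>, its
          power supplies the missing degree without affecting the quotient of values.\<close>
        define s where "s = [:[:ev q / ev q0:]:] * t ^ nat (k - k0)"
        have "hom2 (k - k0) s"
          unfolding s_def
          using hom2_mult[OF hom2_const hom2_power[OF t(1), of "nat (k - k0)"]] le by fastforce
        moreover have "ev (q - s * q0) = 0"
          unfolding s_def ev t using Q0(2) by simp
        ultimately show ?thesis using Q0 by blast
      qed simp
    qed (use Q0 in \<open>auto simp: Q_def\<close>)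
  qed
  define G' where "G' = (\<lambda>(k, x). (k, \<psi> x)) ` G \<union> G0"
  have fin: "finite G'" using G(1) G0(1) by (simp add: G'_def)
  have card: "card G' \<le> Suc m"
    using card_Un_le[of "(\<lambda>(k, x). (k, \<psi> x)) ` G" G0] card_image_le[OF G(1), of "\<lambda>(k, x). (k, \<psi> x)"]
      G(2) G0(2) unfolding G'_def by linarith
  have mem: "x \<in> N k" if "(k, x) \<in> G'" for k x
    using G(3) G0(3) that unfolding G'_def by (cases x) auto
  have sub: "N k \<subseteq> W' k"
    if W': "gsub W'" and W'gen: "\<And>k x. (k, x) \<in> G' \<Longrightarrow> x \<in> W' k"
      and mod: "\<And>k p q. (h1 * h' * p, h1 * h' * q) \<in> N k \<Longrightarrow> hom2 (k + \<alpha> - int (Suc m)) p \<Longrightarrow>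
          hom2 (k + \<beta> - int (Suc m)) q \<Longrightarrow> (h1 * h' * p, h1 * h' * q) \<in> W' k" for W' k
  proof -
    have incl: "{x. \<psi> x \<in> N k} \<subseteq> {x. \<psi> x \<in> W' k}" for k
    proof (rule generates_mod_subset[OF gen])
      show "gsub (\<lambda>k. {x. \<psi> x \<in> W' k})"
        unfolding gsub_def
      proof (intro conjI allI impI; clarsimp)
        fix k a b a' b' assume "\<psi> (a, b) \<in> W' k" "\<psi> (a', b') \<in> W' k"
        from gsub_add[OF W' this] show "\<psi> (a + a', b + b') \<in> W' k"
          by (simp add: \<psi> algebra_simps)
      next
        fix k n r a b assume "\<psi> (a, b) \<in> W' k" "hom2 n r"
        from gsub_mult[OF W' this(1)[unfolded \<psi>] this(2)] show "\<psi> (r * a, r * b) \<in> W' (k + n)"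
          by (simp add: \<psi> algebra_simps)
      qed
    next
      fix k x assume "(k, x) \<in> G"
      then have "(k, \<psi> x) \<in> G'" by (force simp: G'_def)
      then show "x \<in> {x. \<psi> x \<in> W' k}" using W'gen by simp
    next
      fix k p q
      assume "(h' * p, h' * q) \<in> {x. \<psi> x \<in> N k}" "hom2 (k + (\<alpha> - 1) - int m) p" "hom2 (k + \<beta> - int m) q"
      then have Q: "Q (k, p, q)" by (simp add: Q_def algebra_simps)
      \<comment> \<open>If \<open>q\<close> vanishes at the zero of \<open>h1\<close>, then
        \<open>h1\<close> divides it, and both coordinates of \<open>\<psi> (h' * p, h' * q)\<close>
        are multiples of \<open>h1 * h'\<close>.\<close>
      have vanish: "\<psi> (h' * p, h' * q) \<in> W' k" if Q: "Q (k, p, q)" and "ev q = 0" for p q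
      proof -
        have "hom2 (k + \<beta> - int m) q" using Q by (simp add: Q_def)
        from dvd[OF this \<open>ev q = 0\<close>] obtain q' where q': "q = q' * h1"
          by (metis dvd_def mult.commute)
        have "hom2 (k + \<beta> - int m - 1 + 1) (q' * h1)"
          using Q by (simp add: Q_def q')
        from hom2_cancel[OF this h1] have hq': "hom2 (k + \<beta> - int (Suc m)) q'"
          by (simp add: algebra_simps)
        have "hom2 (k + \<alpha> - int (Suc m)) (\<delta> * q')"
          using hom2_mult[OF \<delta> hq'] by (simp add: algebra_simps)
        then have hp: "hom2 (k + \<alpha> - int (Suc m)) (\<delta> * q' + p)"
          using Q by (intro hom2_add) (auto simp: Q_def algebra_simps)
        have eq: "\<psi> (h' * p, h' * q) = (h1 * h' * (\<delta> * q' + p), h1 * h' * q')"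
          by (simp add: \<psi> q' algebra_simps)
        show ?thesis
          using mod hp hq' Q unfolding eq Q_def by (simp add: eq)
      qed
      have "\<psi> (h' * p, h' * q) \<in> W' k"
      proof (cases "ev q = 0")
        case True
        then show ?thesis using vanish Q by blast
      next
        case False
        then obtain k0 p0 q0 s where g: "(k0, \<psi> (h' * p0, h' * q0)) \<in> G0" and Q0: "Q (k0, p0, q0)"
          and s: "hom2 (k - k0) s" "ev (q - s * q0) = 0"
          using reduce[OF Q] by blast
        have eq: "\<psi> (h' * (p - s * p0), h' * (q - s * q0)) =
            \<psi> (h' * p, h' * q) - (s * fst (\<psi> (h' * p0, h' * q0)), s * snd (\<psi> (h' * p0, h' * q0)))"
          by (simp add: \<psi> algebra_simps)
        have "(s * fst (\<psi> (h' * p0, h' * q0)), s * snd (\<psi> (h' * p0, h' * q0))) \<in> N (k0 + (k - k0))"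
          using Q0 s(1) by (intro gsub_mult[OF N]) (auto simp: Q_def)
        then have "\<psi> (h' * (p - s * p0), h' * (q - s * q0)) \<in> N k"
          unfolding eq using Q by (intro gsub_diff[OF N]) (auto simp: Q_def)
        moreover have "hom2 (k + \<alpha> - 1 - int m) (p - s * p0)"
          using hom2_mult[OF s(1), of "k0 + \<alpha> - 1 - int m" p0] Q Q0
          by (intro hom2_diff) (auto simp: Q_def algebra_simps)
        moreover have "hom2 (k + \<beta> - int m) (q - s * q0)"
          using hom2_mult[OF s(1), of "k0 + \<beta> - int m" q0] Q Q0
          by (intro hom2_diff) (auto simp: Q_def algebra_simps)
        ultimately have 1: "\<psi> (h' * (p - s * p0), h' * (q - s * q0)) \<in> W' k"
          using s(2) by (intro vanish) (auto simp: Q_def)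
        have "\<psi> (h' * p0, h' * q0) \<in> W' k0" by (rule W'gen) (simp add: G'_def g)
        then have 2: "(s * fst (\<psi> (h' * p0, h' * q0)), s * snd (\<psi> (h' * p0, h' * q0))) \<in> W' (k0 + (k - k0))"
          using s(1) by (intro gsub_mult[OF W']) auto
        have "\<psi> (h' * (p - s * p0), h' * (q - s * q0)) +
            (s * fst (\<psi> (h' * p0, h' * q0)), s * snd (\<psi> (h' * p0, h' * q0))) \<in> W' k"
          using 1 2 by (intro gsub_add[OF W']) auto
        then show ?thesis unfolding eq by simp
      qed
      then show "(h' * p, h' * q) \<in> {x. \<psi> x \<in> W' k}" by simp
    qed
    show ?thesis
    proof
      fix x assume x: "x \<in> N k"
      obtain a b where ab: "x = (a, b)" by (cases x)
      obtain a' where "a - \<delta> * b = h1 * a'" using red x ab by blast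
      then have "x = \<psi> (a', b)" by (simp add: \<psi> ab algebra_simps)
      then show "x \<in> W' k" using incl[of k] x by blast
    qed
  qed
  show ?thesis
  proof (rule exI, rule generates_modI[OF fin card mem])
    fix W k
    assume "gsub W" "\<And>k x. (k, x) \<in> G' \<Longrightarrow> x \<in> W k"
      "\<And>k p q. (h1 * h' * p, h1 * h' * q) \<in> N k \<Longrightarrow> hom2 (k + \<alpha> - int (Suc m)) p \<Longrightarrow>
          hom2 (k + \<beta> - int (Suc m)) q \<Longrightarrow> (h1 * h' * p, h1 * h' * q) \<in> W k"
    then show "N k \<subseteq> W k" by (rule sub)
  qed
qed

text \<open>Induction on the linear factors. Because the determinants vanish at the zero of the
  first factor, a change of coordinates makes one coordinate divisible by it; dividing it out
  removes the factor from the determinants at the price of one generator.\<close>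

lemma generates_mod_of_dets:
  assumes "gsub N"
    and "\<And>k a b. (a, b) \<in> N k \<Longrightarrow> hom2 (k + \<alpha>) a \<and> hom2 (k + \<beta>) b"
    and "\<And>h. h \<in> set hs \<Longrightarrow> hom2 1 h \<and> h \<noteq> 0"
    and "\<And>k k' a b a' b'. (a, b) \<in> N k \<Longrightarrow> (a', b') \<in> N k' \<Longrightarrow> prod_list hs dvd a * b' - a' * b"
  shows "\<exists>G. generates_mod (length hs) \<alpha> \<beta> (prod_list hs) N G"
  using assms
proof (induction hs arbitrary: N \<alpha> \<beta>)
  case Nil
  then show ?case by (intro exI[of _ "{}"] generates_modI) auto
next
  case (Cons h1 hs)
  define h' where "h' = prod_list hs"
  have h1: "hom2 1 h1" "h1 \<noteq> 0" using Cons.prems(3) by auto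
  have h': "hom2 (int (length hs)) h'" "h' \<noteq> 0"
  proof -
    have "hom2 (int (length hs)) (prod_list hs) \<and> prod_list hs \<noteq> 0"
      if "\<And>h. h \<in> set hs \<Longrightarrow> hom2 1 h \<and> h \<noteq> 0" for hs
      using that
    proof (induction hs)
      case Nil
      then show ?case using hom2_const[of 1] by (simp add: one_pCons)
    next
      case (Cons h hs)
      then show ?case using hom2_mult[of 1 h "int (length hs)" "prod_list hs"] by auto
    qed
    then show "hom2 (int (length hs)) h'" "h' \<noteq> 0" using Cons.prems(3) by (auto simp: h'_def)
  qed
  have step: "\<exists>G. generates_mod (Suc (length hs)) \<alpha> \<beta> (h1 * h') N G"
    if N: "gsub N" and deg: "\<And>k a b. (a, b) \<in> N k \<Longrightarrow> hom2 (k + \<alpha>) a \<and> hom2 (k + \<beta>) b"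
    and dets: "\<And>k k' a b a' b'. (a, b) \<in> N k \<Longrightarrow> (a', b') \<in> N k' \<Longrightarrow> h1 * h' dvd a * b' - a' * b"
    and \<delta>: "hom2 (\<alpha> - \<beta>) \<delta>" and red: "\<And>k a b. (a, b) \<in> N k \<Longrightarrow> h1 dvd a - \<delta> * b"
    for N \<alpha> \<beta> \<delta>
  proof (rule generates_mod_step[OF N h1 h' \<delta> red])
    let ?\<phi> = "\<lambda>(a, b). (\<delta> * b + h1 * a, b)"
    show "\<exists>G. generates_mod (length hs) (\<alpha> - 1) \<beta> h' (\<lambda>k. {x. ?\<phi> x \<in> N k}) G"
      unfolding h'_def
    proof (rule Cons.IH)
      show "gsub (\<lambda>k. {x. ?\<phi> x \<in> N k})"
        unfolding gsub_def
      proof (intro conjI allI impI; clarsimp)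
        fix k a b a' b' assume "(\<delta> * b + h1 * a, b) \<in> N k" "(\<delta> * b' + h1 * a', b') \<in> N k"
        from gsub_add[OF N this] show "(\<delta> * (b + b') + h1 * (a + a'), b + b') \<in> N k"
          by (simp add: algebra_simps)
      next
        fix k n r a b assume "(\<delta> * b + h1 * a, b) \<in> N k" "hom2 n r"
        from gsub_mult[OF N this] show "(\<delta> * (r * b) + h1 * (r * a), r * b) \<in> N (k + n)"
          by (simp add: algebra_simps)
      qed
    next
      fix k a b assume "(a, b) \<in> {x. ?\<phi> x \<in> N k}"
      then have *: "hom2 (k + \<alpha>) (\<delta> * b + h1 * a)" "hom2 (k + \<beta>) b" using deg[of _ b k] by auto
      have "hom2 (k + \<alpha>) (\<delta> * b)" using hom2_mult[OF \<delta> *(2)] by (simp add: algebra_simps)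
      from hom2_diff[OF *(1) this] have "hom2 (k + (\<alpha> - 1) + 1) (a * h1)" by (simp add: mult.commute)
      from hom2_cancel[OF this h1] show "hom2 (k + (\<alpha> - 1)) a \<and> hom2 (k + \<beta>) b" using * by simp
    next
      fix k k' a b a' b'
      assume "(a, b) \<in> {x. ?\<phi> x \<in> N k}" "(a', b') \<in> {x. ?\<phi> x \<in> N k'}"
      then have "h1 * h' dvd (\<delta> * b + h1 * a) * b' - (\<delta> * b' + h1 * a') * b" using dets by auto
      \<comment> \<open>The change of coordinates has determinant \<open>h1\<close>, so one factor
        \<open>h1\<close> cancels.\<close>
      also have "(\<delta> * b + h1 * a) * b' - (\<delta> * b' + h1 * a') * b = h1 * (a * b' - a' * b)"
        by (simp add: algebra_simps)
      finally show "prod_list hs dvd a * b' - a' * b" using h1(2) by (simp add: h'_def)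
    qed (use Cons.prems(3) in auto)
  qed
  obtain ev t where z: "zero_of h1 ev t" using ex_zero_of[OF h1] by blast
  then have ev: "ev (p + q) = ev p + ev q" "ev (p - q) = ev p - ev q"
    "ev (p * q) = ev p * ev q" "ev [:[:c:]:] = c" "ev (p ^ n) = ev p ^ n" for p q c n
    by (simp_all add: zero_of_def)
  have t: "hom2 1 t" "ev t = 1" and ev_h1: "ev h1 = 0"
    and dvd: "\<And>n p. hom2 n p \<Longrightarrow> ev p = 0 \<Longrightarrow> h1 dvd p"
    using z by (auto simp: zero_of_def)
  \<comment> \<open>Modulo \<open>h1\<close> all determinants vanish, so at the zero of \<open>h1\<close> the values of \<open>N\<close> lie on one line of \<open>\<complex>\<^sup>2\<close>.\<close>
  have wlog: "\<exists>G. generates_mod (Suc (length hs)) \<alpha> \<beta> (h1 * h') N G"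
    if N: "gsub N" and deg: "\<And>k a b. (a, b) \<in> N k \<Longrightarrow> hom2 (k + \<alpha>) a \<and> hom2 (k + \<beta>) b"
    and dets: "\<And>k k' a b a' b'. (a, b) \<in> N k \<Longrightarrow> (a', b') \<in> N k' \<Longrightarrow> h1 * h' dvd a * b' - a' * b"
    and le: "\<beta> \<le> \<alpha>" for N and \<alpha> \<beta> :: int
  proof (cases "\<forall>k a b. (a, b) \<in> N k \<longrightarrow> ev b = 0")
    case True
    \<comment> \<open>All second coordinates are divisible by \<open>h1\<close>. After the swap
      \<open>\<delta> = 0\<close> works: it is homogeneous of every degree, even the possibly
      negative \<open>\<beta> - \<alpha>\<close>.\<close>
    have "\<exists>G. generates_mod (Suc (length hs)) \<beta> \<alpha> (h1 * h') (\<lambda>k. prod.swap ` N k) G"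
    proof (rule step)
      show "gsub (\<lambda>k. prod.swap ` N k)"
        by (rule gsub_swap[OF N])
      show "hom2 (\<beta> - \<alpha>) 0" by simp
      fix k a b assume ab: "(a, b) \<in> prod.swap ` N k"
      show "hom2 (k + \<beta>) a \<and> hom2 (k + \<alpha>) b" using deg ab by auto
      then show "h1 dvd a - 0 * b" using ab dvd[of _ a] True by auto
    next
      fix k k' a b a' b' assume "(a, b) \<in> prod.swap ` N k" "(a', b') \<in> prod.swap ` N k'"
      then have "h1 * h' dvd b' * a - b * a'" using dets[of b' a' k' b a k] by auto
      then show "h1 * h' dvd a * b' - a' * b" by (simp add: mult.commute)
    qed
    then show ?thesis by (rule generates_mod_swap)
  next
    case False
    then obtain k0 a0 b0 where 0: "(a0, b0) \<in> N k0" "ev b0 \<noteq> 0" by blast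
    \<comment> \<open>At the zero of \<open>h1\<close> its value is the slope of the common line;
      \<open>\<beta> \<le> \<alpha>\<close> makes the degree \<open>\<alpha> - \<beta>\<close>
      attainable.\<close>
    define \<delta> where "\<delta> = [:[:ev a0 / ev b0:]:] * t ^ nat (\<alpha> - \<beta>)"
    have \<delta>: "hom2 (\<alpha> - \<beta>) \<delta>"
      unfolding \<delta>_def
      using hom2_mult[OF hom2_const hom2_power[OF t(1), of "nat (\<alpha> - \<beta>)"]] le by fastforce
    show ?thesis
    proof (rule step[OF N deg dets \<delta>])
      fix k a b assume ab: "(a, b) \<in> N k"
      have "h1 dvd a * b0 - a0 * b" using dets[OF ab 0(1)] dvd_mult_left by blast
      then have "ev (a * b0 - a0 * b) = 0" unfolding dvd_def using ev(3) ev_h1 by (metis mult_zero_left)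
      then have "ev a * ev b0 = ev a0 * ev b" unfolding ev by simp
      moreover have "ev a0 = ev \<delta> * ev b0"
        unfolding \<delta>_def ev t power_one mult_1_right using 0(2) by simp
      ultimately have "ev a * ev b0 = (ev \<delta> * ev b) * ev b0" by simp
      then have "ev (a - \<delta> * b) = 0" using 0(2) unfolding ev by simp
      moreover have "hom2 (k + \<alpha>) (a - \<delta> * b)"
        using deg[OF ab] hom2_mult[OF \<delta>, of "k + \<beta>" b] by (intro hom2_diff) (auto simp: algebra_simps)
      ultimately show "h1 dvd a - \<delta> * b" using dvd by blast
    qed
  qed
  have "\<exists>G. generates_mod (Suc (length hs)) \<alpha> \<beta> (h1 * h') N G"
  proof (cases "\<beta> \<le> \<alpha>")
    case True
    show ?thesis
      by (rule wlog[OF Cons.prems(1,2) _ True]) (use Cons.prems(4) in \<open>auto simp: h'_def\<close>)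
  next
    case False
    have "\<exists>G. generates_mod (Suc (length hs)) \<beta> \<alpha> (h1 * h') (\<lambda>k. prod.swap ` N k) G"
    proof (rule wlog)
      show "gsub (\<lambda>k. prod.swap ` N k)"
        by (rule gsub_swap[OF Cons.prems(1)])
      fix k a b assume ab: "(a, b) \<in> prod.swap ` N k"
      show "hom2 (k + \<beta>) a \<and> hom2 (k + \<alpha>) b" using Cons.prems(2) ab by auto
    next
      fix k k' a b a' b' assume "(a, b) \<in> prod.swap ` N k" "(a', b') \<in> prod.swap ` N k'"
      then have "h1 * h' dvd b' * a - b * a'" using Cons.prems(4)[of b' a' k' b a k] by (auto simp: h'_def)
      then show "h1 * h' dvd a * b' - a' * b" by (simp add: mult.commute)
    qed (use False in simp)
    then show ?thesis by (rule generates_mod_swap)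
  qed
  then show ?case by (simp add: h'_def)
qed

section \<open>Derivations and linear forms\<close>

lemma additive_sum:
  fixes D :: "'a::ab_group_add \<Rightarrow> 'b::ab_group_add"
  assumes "\<And>a b. D (a + b) = D a + D b"
  shows "D (sum g A) = (\<Sum>a\<in>A. D (g a))"
proof -
  have "D 0 = 0" using assms[of 0 0] by simp
  then show ?thesis by (induction A rule: infinite_finite_induct) (simp_all add: assms)
qed

text \<open>Source of the Leibniz rules: extending \<open>pderiv\<close> once gives
  \<open>deriv_y\<close>, twice gives \<open>deriv_x\<close>.\<close>

lemma map_poly_derivation:
  fixes D :: "'a::comm_ring_1 \<Rightarrow> 'a"
  assumes add: "\<And>a b. D (a + b) = D a + D b" and mult: "\<And>a b. D (a * b) = D a * b + a * D b"
  shows "map_poly D (p + q) = map_poly D p + map_poly D q"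
    and "map_poly D (p * q) = map_poly D p * q + p * map_poly D q"
proof -
  have [simp]: "D 0 = 0" using add[of 0 0] by simp
  show "map_poly D (p + q) = map_poly D p + map_poly D q"
    by (rule poly_eqI) (simp add: coeff_map_poly add)
  show "map_poly D (p * q) = map_poly D p * q + p * map_poly D q"
    by (rule poly_eqI) (simp add: coeff_map_poly coeff_mult additive_sum[of D, OF add] mult sum.distrib)
qed

lemma deriv_mult:
  "deriv_x (p * q) = deriv_x p * q + p * deriv_x q"
  "deriv_y (p * q) = deriv_y p * q + p * deriv_y q"
  "deriv_z (p * q) = deriv_z p * q + p * deriv_z q"
proof -
  have 1: "pderiv (a + b) = pderiv a + pderiv b" "pderiv (a * b) = pderiv a * b + a * pderiv b"
    for a b :: "'b::idom poly"
    by (simp_all add: pderiv_add pderiv_mult mult.commute)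
  note 2 = map_poly_derivation[of pderiv, OF 1]
  show "deriv_x (p * q) = deriv_x p * q + p * deriv_x q"
    unfolding deriv_x_def by (rule map_poly_derivation(2)[OF 2])
  show "deriv_y (p * q) = deriv_y p * q + p * deriv_y q"
    unfolding deriv_y_def by (rule 2(2))
  show "deriv_z (p * q) = deriv_z p * q + p * deriv_z q"
    unfolding deriv_z_def by (rule 1(2))
qed

section \<open>Triples as derivations\<close>

definition der :: "cpoly3 \<times> cpoly3 \<times> cpoly3 \<Rightarrow> cpoly3 \<Rightarrow> cpoly3"
  where "der = (\<lambda>(a, b, c) p. a * deriv_x p + b * deriv_y p + c * deriv_z p)"

lemma AR_iff: "\<theta> \<in> AR f \<longleftrightarrow> der \<theta> f = 0"
  by (cases \<theta>) (simp add: AR_def der_def)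

lemma der_add: "der (\<theta> + \<eta>) p = der \<theta> p + der \<eta> p"
  by (cases \<theta>; cases \<eta>) (simp add: der_def algebra_simps)

lemma der_diff: "der (\<theta> - \<eta>) p = der \<theta> p - der \<eta> p"
  by (cases \<theta>; cases \<eta>) (simp add: der_def algebra_simps)

lemma der_scale: "der (scale3 s \<theta>) p = s * der \<theta> p"
  by (cases \<theta>) (simp add: der_def scale3_def algebra_simps)

lemma der_mult: "der \<theta> (p * q) = der \<theta> p * q + p * der \<theta> q"
  by (cases \<theta>) (simp add: der_def deriv_mult algebra_simps)

lemma der_1: "der \<theta> 1 = 0"
  using der_mult[of \<theta> 1 1] by simp

lemma der_prod: "finite A \<Longrightarrow> der \<theta> (\<Prod>i\<in>A. l i) = (\<Sum>i\<in>A. der \<theta> (l i) * (\<Prod>j\<in>A - {i}. l j))"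
proof (induction A rule: finite_induct)
  case (insert a A)
  have "(\<Prod>j\<in>insert a A - {i}. l j) = l a * (\<Prod>j\<in>A - {i}. l j)" if "i \<in> A" for i
  proof -
    have "insert a A - {i} = insert a (A - {i})" using insert that by auto
    then show ?thesis using insert by simp
  qed
  moreover have "insert a A - {a} = A" using insert by auto
  ultimately show ?case
    using insert by (simp add: der_mult sum_distrib_left algebra_simps)
qed (simp add: der_1)

lemma AR_subspace: "S3.subspace (AR f)"
proof -
  have "der 0 f = 0" using der_scale[of 0 "0" f] by (simp add: zero_prod_def scale3_def)
  then show ?thesis by (simp add: S3.subspace_def AR_iff der_add der_scale)
qed

lemma hom3_deriv:
  assumes "hom3 n p"
  shows "hom3 (n - 1) (deriv_x p)" "hom3 (n - 1) (deriv_y p)" "hom3 (n - 1) (deriv_z p)"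
  using assms unfolding hom3_def coeff3_deriv_x coeff3_deriv_y coeff3_deriv_z by fastforce+

abbreviation cst :: "complex \<Rightarrow> cpoly3" where "cst c \<equiv> [:[:[:c:]:]:]"

lemma hom3_0_eq:
  assumes "hom3 0 p"
  shows "p = cst (coeff3 p 0 0 0)"
proof (rule coeff3_eqI)
  fix i j k
  have "coeff3 p i j k = 0" if "i + j + k \<noteq> 0"
    using assms that unfolding hom3_def by (metis of_nat_0 of_nat_eq_iff)
  then show "coeff3 p i j k = coeff3 (cst (coeff3 p 0 0 0)) i j k"
    by (auto simp: coeff3_def coeff_pCons split: nat.splits)
qed

lemma hom3_1_eq:
  assumes "hom3 1 l"
  shows "l = [:[:[:0, coeff3 l 1 0 0:], [:coeff3 l 0 1 0:]:], [:[:coeff3 l 0 0 1:]:]:]"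
proof (rule coeff3_eqI)
  fix i j k
  have "coeff3 l i j k = 0" if "i + j + k \<noteq> 1"
    using assms that unfolding hom3_def by (metis of_nat_1 of_nat_eq_iff)
  then show "coeff3 l i j k =
      coeff3 [:[:[:0, coeff3 l 1 0 0:], [:coeff3 l 0 1 0:]:], [:[:coeff3 l 0 0 1:]:]:] i j k"
    by (auto simp: coeff3_def coeff_pCons split: nat.splits)
qed

lemma der_linear:
  assumes "hom3 1 l"
  shows "der (a, b, c) l = a * cst (coeff3 l 1 0 0) + b * cst (coeff3 l 0 1 0) + c * cst (coeff3 l 0 0 1)"
proof -
  have "deriv_x l = cst (coeff3 l 1 0 0)" "deriv_y l = cst (coeff3 l 0 1 0)" "deriv_z l = cst (coeff3 l 0 0 1)"
    using hom3_0_eq[OF hom3_deriv(1)[OF assms, simplified]]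
      hom3_0_eq[OF hom3_deriv(2)[OF assms, simplified]]
      hom3_0_eq[OF hom3_deriv(3)[OF assms, simplified]]
    by (simp_all add: coeff3_deriv_x coeff3_deriv_y coeff3_deriv_z)
  then show ?thesis by (simp add: der_def)
qed

lemma eval3_linear:
  assumes "hom3 1 l"
  shows "eval3 l (u, v, w) = coeff3 l 1 0 0 * u + coeff3 l 0 1 0 * v + coeff3 l 0 0 1 * w"
  by (subst hom3_1_eq[OF assms]) (simp add: eval3_def algebra_simps)

definition homt :: "int \<Rightarrow> cpoly3 \<times> cpoly3 \<times> cpoly3 \<Rightarrow> bool"
  where "homt n = (\<lambda>(a, b, c). hom3 n a \<and> hom3 n b \<and> hom3 n c)"

lemma homt_add: "homt n \<theta> \<Longrightarrow> homt n \<eta> \<Longrightarrow> homt n (\<theta> + \<eta>)"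
  by (cases \<theta>; cases \<eta>) (simp add: homt_def hom3_add)

lemma homt_diff: "homt n \<theta> \<Longrightarrow> homt n \<eta> \<Longrightarrow> homt n (\<theta> - \<eta>)"
  by (cases \<theta>; cases \<eta>) (simp add: homt_def hom3_diff)

lemma homt_scale: "hom3 m s \<Longrightarrow> homt n \<theta> \<Longrightarrow> homt (m + n) (scale3 s \<theta>)"
  by (cases \<theta>) (simp add: homt_def scale3_def hom3_mult)

lemma hom3_neg: "n < 0 \<Longrightarrow> hom3 n p \<Longrightarrow> p = 0"
  by (rule coeff3_eqI) (force simp: hom3_def)

lemma homt_neg:
  assumes "n < 0" "homt n \<theta>"
  shows "\<theta> = 0"
  using assms hom3_neg[OF assms(1)] by (cases \<theta>) (auto simp: homt_def zero_prod_def)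

lemma homogeneous_triple_of_homt:
  assumes "homt n \<theta>"
  shows "\<exists>m. homogeneous_triple m \<theta>"
proof (cases "n < 0")
  case True
  then show ?thesis
    using homt_neg[OF True assms]
    by (simp add: homogeneous_triple_def homogeneous_iff_hom3 zero_prod_def)
next
  case False
  then show ?thesis
    using assms by (intro exI[of _ "nat n"])
      (cases \<theta>; simp add: homogeneous_triple_def homogeneous_iff_hom3 homt_def)
qed

lemma hom3_der_linear:
  assumes "homt n \<theta>" "hom3 1 l"
  shows "hom3 n (der \<theta> l)"
proof -
  obtain a b c where "\<theta> = (a, b, c)" by (cases \<theta>)
  moreover have "hom3 n (p * cst s)" if "hom3 n p" for p s
    using hom3_cmult[OF that] by (simp only: mult.commute)
  ultimately show ?thesis
    using assms by (simp only: der_linear homt_def split_conv hom3_add)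
qed

definition partt :: "int \<Rightarrow> cpoly3 \<times> cpoly3 \<times> cpoly3 \<Rightarrow> cpoly3 \<times> cpoly3 \<times> cpoly3"
  where "partt n = (\<lambda>(a, b, c). (part3 n a, part3 n b, part3 n c))"

lemma homt_partt: "homt n (partt n \<theta>)"
  by (cases \<theta>) (simp add: homt_def partt_def hom3_part3)

lemma sum_partt: "\<exists>m. \<theta> = (\<Sum>r\<le>m. partt (int r) \<theta>)"
proof -
  obtain a b c where \<theta>: "\<theta> = (a, b, c)" by (cases \<theta>)
  obtain na nb nc where n: "\<And>m. m \<ge> na \<Longrightarrow> a = (\<Sum>r\<le>m. part3 (int r) a)"
    "\<And>m. m \<ge> nb \<Longrightarrow> b = (\<Sum>r\<le>m. part3 (int r) b)" "\<And>m. m \<ge> nc \<Longrightarrow> c = (\<Sum>r\<le>m. part3 (int r) c)"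
    using sum_part3 by metis
  define m where "m = na + nb + nc"
  have "(\<Sum>r\<le>m. partt (int r) \<theta>) =
      (\<Sum>r\<le>m. part3 (int r) a, \<Sum>r\<le>m. part3 (int r) b, \<Sum>r\<le>m. part3 (int r) c)"
    by (simp add: prod_eq_iff fst_sum snd_sum partt_def \<theta>)
  also have "\<dots> = \<theta>"
    using n(1)[of m] n(2)[of m] n(3)[of m] unfolding \<theta> m_def by simp
  finally show ?thesis by metis
qed

text \<open>The partial derivatives of a form share one degree, so the syzygy equation splits by
  degrees and \<open>AR f\<close> is graded.\<close>

lemma partt_AR:
  assumes "\<theta> \<in> AR f" "hom3 n f"
  shows "partt k \<theta> \<in> AR f"
proof -
  obtain a b c where \<theta>: "\<theta> = (a, b, c)" by (cases \<theta>)
  note h = hom3_deriv[OF assms(2)]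
  have "der (partt k \<theta>) f = part3 (k + (n - 1)) (der \<theta> f)"
    by (simp add: \<theta> partt_def der_def part3_add part3_mult_hom3[OF h(1)]
        part3_mult_hom3[OF h(2)] part3_mult_hom3[OF h(3)])
  then show ?thesis using assms(1) by (simp add: AR_iff)
qed

section \<open>Primality of linear forms\<close>

lemma dvd_linear_iff:
  fixes a u v :: "'a::idom_divide"
  assumes "u * v = 1"
  shows "[:a, u:] dvd x \<longleftrightarrow> poly x (- (v * a)) = 0"
proof -
  have "v * a * u = a" using assms by (metis mult.assoc mult.commute mult_1_left)
  then have eq: "[:a, u:] = [:u:] * [:- (- (v * a)), 1:]" by simp
  have "[:u:] dvd 1" by (rule dvdI[of _ _ "[:v:]"]) (simp add: assms one_pCons mult.commute[of v u])
  then show ?thesis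
    by (simp only: eq poly_eq_0_iff_dvd mult_unit_dvd_iff')
qed

text \<open>Divisibility means vanishing at the root, and evaluation there is a homomorphism into a
  domain.\<close>

lemma prime_elem_linear:
  fixes a u :: "'a::idom_divide"
  assumes "u dvd 1"
  shows "prime_elem [:a, u:]"
proof -
  obtain v where uv: "u * v = 1" using assms by (metis dvdE)
  show ?thesis
    using uv by (intro prime_elemI) (auto simp: dvd_linear_iff[OF uv])
qed

lemma cst_dvd_1: "c \<noteq> 0 \<Longrightarrow> [:c:] dvd 1" for c :: complex
  by (rule dvdI[of _ _ "[:1 / c:]"]) (simp add: one_pCons)

lemma const_dvd_1: "p dvd 1 \<Longrightarrow> [:p:] dvd 1" for p :: "'a::idom"
  by (metis const_poly_dvd_const_poly_iff one_pCons)

text \<open>In the outermost variable that occurs, the form is linear with a unit as leading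
  coefficient; variables further out only add layers of constant polynomials.\<close>

lemma prime_elem_linear_form:
  assumes "linear_form l"
  shows "prime_elem l"
proof -
  define p q r where "p = coeff3 l 1 0 0" and "q = coeff3 l 0 1 0" and "r = coeff3 l 0 0 1"
  have l: "l = [:[:[:0, p:], [:q:]:], [:[:r:]:]:]" and nz: "l \<noteq> 0"
    using hom3_1_eq[of l] assms by (simp_all add: linear_form_def homogeneous_iff_hom3 p_def q_def r_def)
  show ?thesis
  proof (cases "r = 0")
    case False
    then show ?thesis unfolding l by (intro prime_elem_linear const_dvd_1 cst_dvd_1)
  next
    case r: True
    show ?thesis
    proof (cases "q = 0")
      case False
      then show ?thesis
        unfolding l r by (simp add: prime_elem_const_poly_iff prime_elem_linear cst_dvd_1)
    next
      case True
      then have "p \<noteq> 0" using nz l r by auto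
      then have "prime_elem [:0, p:]" by (intro prime_elem_linear) (simp add: dvd_field_iff)
      then show ?thesis
        unfolding l r True by (simp add: prime_elem_const_poly_iff)
    qed
  qed
qed

lemma linear_form_dvd_imp_proportional:
  assumes "linear_form l" "linear_form l'" "l dvd l'"
  shows "proportional l' l"
proof -
  obtain g where g: "l' = g * l" using assms(3) by (metis dvdE mult.commute)
  have "hom3 (0 + 1) (g * l)" "hom3 1 l" "l \<noteq> 0" "g \<noteq> 0"
    using assms g by (auto simp: linear_form_def homogeneous_iff_hom3)
  then have "hom3 0 g" "g \<noteq> 0" using hom3_cancel by blast+
  then show ?thesis
    unfolding proportional_def using g hom3_0_eq[of g] by (metis pCons_0_0)
qed

lemma prime_elem_dvd_prod:
  assumes "prime_elem (p :: 'a::comm_semiring_1)" "finite A" "p dvd (\<Prod>i\<in>A. l i)"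
  shows "\<exists>i\<in>A. p dvd l i"
  using assms(2,3)
proof (induction A rule: finite_induct)
  case empty
  then show ?case using assms(1) by (simp add: prime_elem_def)
next
  case (insert a A)
  then show ?case using prime_elem_dvd_multD[OF assms(1), of "l a" "\<Prod>i\<in>A. l i"] by auto
qed

text \<open>By primality no \<open>l a\<close> divides the product of the others, so the factors
  split off \<open>x\<close> one after another.\<close>

lemma prod_primes_dvd:
  fixes l :: "'i \<Rightarrow> 'a::idom"
  assumes "finite A" "\<And>i. i \<in> A \<Longrightarrow> prime_elem (l i)" "\<And>i. i \<in> A \<Longrightarrow> l i dvd x"
    and "\<And>i j. i \<in> A \<Longrightarrow> j \<in> A \<Longrightarrow> i \<noteq> j \<Longrightarrow> \<not> l i dvd l j"
  shows "(\<Prod>i\<in>A. l i) dvd x"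
  using assms
proof (induction A rule: finite_induct)
  case (insert a A)
  have "(\<Prod>i\<in>A. l i) dvd x" by (rule insert.IH) (use insert.prems in auto)
  then obtain y where y: "x = (\<Prod>i\<in>A. l i) * y" by (rule dvdE)
  have "\<not> l a dvd (\<Prod>i\<in>A. l i)"
    using prime_elem_dvd_prod[of "l a" A l] insert.prems(1,3) insert.hyps by (metis insert_iff)
  then have "l a dvd y"
    using y insert.prems(1,2) prime_elem_dvd_multD[of "l a" "\<Prod>i\<in>A. l i" y] by auto
  then show ?case using y insert.hyps by (simp add: mult.commute mult_dvd_mono)
qed simp

text \<open>The witnesses are the entries of the adjugate over the determinant: the columns
  \<open>(x, y, z)\<close> invert the matrix with rows \<open>(p, q, r)\<close>. The first six
  equations express duality, the other nine recover a vector from its values.\<close>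

lemma dual_frame:
  fixes p0 q0 r0 p1 q1 r1 p2 q2 r2 :: "'a::field"
  assumes "p2 * (q0 * r1 - q1 * r0) + q2 * (r0 * p1 - r1 * p0) + r2 * (p0 * q1 - p1 * q0) \<noteq> 0"
  obtains x0 y0 z0 x1 y1 z1 x2 y2 z2 where
    "p0 * x1 + q0 * y1 + r0 * z1 = 0" "p1 * x1 + q1 * y1 + r1 * z1 = 1" "p2 * x1 + q2 * y1 + r2 * z1 = 0"
    "p0 * x2 + q0 * y2 + r0 * z2 = 0" "p1 * x2 + q1 * y2 + r1 * z2 = 0" "p2 * x2 + q2 * y2 + r2 * z2 = 1"
    "p0 * x0 + p1 * x1 + p2 * x2 = 1" "q0 * x0 + q1 * x1 + q2 * x2 = 0" "r0 * x0 + r1 * x1 + r2 * x2 = 0"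
    "p0 * y0 + p1 * y1 + p2 * y2 = 0" "q0 * y0 + q1 * y1 + q2 * y2 = 1" "r0 * y0 + r1 * y1 + r2 * y2 = 0"
    "p0 * z0 + p1 * z1 + p2 * z2 = 0" "q0 * z0 + q1 * z1 + q2 * z2 = 0" "r0 * z0 + r1 * z1 + r2 * z2 = 1"
proof -
  define D where "D = inverse (p2 * (q0 * r1 - q1 * r0) + q2 * (r0 * p1 - r1 * p0) + r2 * (p0 * q1 - p1 * q0))"
  have D: "(p2 * (q0 * r1 - q1 * r0) + q2 * (r0 * p1 - r1 * p0) + r2 * (p0 * q1 - p1 * q0)) * D = 1"
    unfolding D_def using assms by (rule right_inverse)
  show thesis
    by (rule that[of
          "(q2 * r0 - q0 * r2) * D" "(r2 * p0 - r0 * p2) * D" "(p2 * q0 - p0 * q2) * D"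
          "(q0 * r1 - q1 * r0) * D" "(r0 * p1 - r1 * p0) * D" "(p0 * q1 - p1 * q0) * D"
          "(q1 * r2 - q2 * r1) * D" "(r1 * p2 - r2 * p1) * D" "(p1 * q2 - p2 * q1) * D"])
      (use D in \<open>simp add: algebra_simps\<close>)+
qed

section \<open>Line arrangements\<close>

definition euler :: "cpoly3 \<times> cpoly3 \<times> cpoly3"
  where "euler = ([:[:[:0, 1:]:]:], [:[:0, 1:]:], [:0, 1:])"

lemma homt_euler: "homt 1 euler"
  by (auto simp: homt_def euler_def hom3_def coeff3_def coeff_pCons split: nat.splits)

lemma der_euler_linear:
  assumes "hom3 1 l"
  shows "der euler l = l"
  unfolding euler_def der_linear[OF assms] by (subst (4) hom3_1_eq[OF assms]) (simp add: one_pCons)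

locale line_arrangement =
  fixes d :: nat and l :: "nat \<Rightarrow> cpoly3"
  assumes linear: "\<And>i. i < d \<Longrightarrow> linear_form (l i)"
    and distinct: "\<And>i j. i < d \<Longrightarrow> j < d \<Longrightarrow> i \<noteq> j \<Longrightarrow> \<not> proportional (l i) (l j)"
begin

definition f :: cpoly3 where "f = (\<Prod>i<d. l i)"

lemma hom3_l: "i < d \<Longrightarrow> hom3 1 (l i)"
  and l_nonzero: "i < d \<Longrightarrow> l i \<noteq> 0"
  using linear by (auto simp: linear_form_def homogeneous_iff_hom3)

lemma prime_l: "i < d \<Longrightarrow> prime_elem (l i)"
  using linear prime_elem_linear_form by blast

lemma not_dvd: "i < d \<Longrightarrow> j < d \<Longrightarrow> i \<noteq> j \<Longrightarrow> \<not> l i dvd l j"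
  using linear_form_dvd_imp_proportional linear distinct by metis

lemma f_nonzero: "f \<noteq> 0"
  by (simp add: f_def l_nonzero)

lemma hom3_prod: "A \<subseteq> {..<d} \<Longrightarrow> hom3 (int (card A)) (\<Prod>i\<in>A. l i)"
proof (induction A rule: infinite_finite_induct)
  case empty
  show ?case using hom3_const[of 1] by (simp add: one_pCons)
next
  case (insert a A)
  then show ?case using hom3_mult[of 1 "l a" "int (card A)" "\<Prod>i\<in>A. l i"] hom3_l[of a] by simp
qed (use finite_subset in blast)

text \<open>Logarithmic differentiation: the eigenvalues \<open>c i\<close> of the factors add
  up.\<close>

lemma der_f:
  assumes "\<And>i. i < d \<Longrightarrow> der \<theta> (l i) = c i * l i"
  shows "der \<theta> f = (\<Sum>i<d. c i) * f"
proof -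
  have "der \<theta> f = (\<Sum>i<d. c i * (l i * (\<Prod>j\<in>{..<d} - {i}. l j)))"
    unfolding f_def der_prod[OF finite_lessThan] using assms by (intro sum.cong) (auto simp: mult.assoc)
  also have "\<dots> = (\<Sum>i<d. c i * f)"
    by (intro sum.cong refl) (simp add: f_def prod.remove[of "{..<d}"])
  finally show ?thesis by (simp add: sum_distrib_right)
qed

lemma der_euler_f: "der euler f = of_nat d * f"
  using der_f[of euler "\<lambda>_. 1"] der_euler_linear hom3_l by simp

text \<open>In the Leibniz expansion of \<open>der \<theta> f = 0\<close> all terms but the
  \<open>i\<close>-th contain \<open>l i\<close>, which is prime and divides no other form.\<close>

lemma AR_dvd:
  assumes "\<theta> \<in> AR f" "i < d"
  shows "l i dvd der \<theta> (l i)"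
proof -
  have "0 = (\<Sum>k<d. der \<theta> (l k) * (\<Prod>j\<in>{..<d} - {k}. l j))"
    using assms(1) by (simp add: AR_iff f_def der_prod)
  also have "\<dots> = der \<theta> (l i) * (\<Prod>j\<in>{..<d} - {i}. l j) +
      (\<Sum>k\<in>{..<d} - {i}. der \<theta> (l k) * (\<Prod>j\<in>{..<d} - {k}. l j))"
    using assms(2) by (simp add: sum.remove)
  finally have "der \<theta> (l i) * (\<Prod>j\<in>{..<d} - {i}. l j) =
      - (\<Sum>k\<in>{..<d} - {i}. der \<theta> (l k) * (\<Prod>j\<in>{..<d} - {k}. l j))"
    by (simp only: eq_neg_iff_add_eq_0)
  moreover have "l i dvd (\<Sum>k\<in>{..<d} - {i}. der \<theta> (l k) * (\<Prod>j\<in>{..<d} - {k}. l j))"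
    using assms(2) by (intro dvd_sum dvd_mult dvd_prodI) auto
  ultimately have "l i dvd der \<theta> (l i) * (\<Prod>j\<in>{..<d} - {i}. l j)" by simp
  moreover have "\<not> l i dvd (\<Prod>j\<in>{..<d} - {i}. l j)"
  proof
    assume "l i dvd (\<Prod>j\<in>{..<d} - {i}. l j)"
    then obtain j where "j \<in> {..<d} - {i}" "l i dvd l j"
      using prime_elem_dvd_prod[OF prime_l[OF assms(2)], of "{..<d} - {i}" l] by blast
    then show False using not_dvd[of i j] assms(2) by simp
  qed
  ultimately show ?thesis using prime_elem_dvd_multD[OF prime_l[OF assms(2)]] by blast
qed

end

text \<open>\<open>E1\<close> and \<open>E2\<close> are constant derivations dual to
  \<open>l i1\<close> and \<open>l i2\<close>, and \<open>frame\<close> recovers a derivation from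
  its values on three forms. \<open>z_coeff\<close> allows \<open>l i0 = 0\<close> to be solved for
  z.\<close>

locale framed_arrangement = line_arrangement +
  fixes i0 i1 i2 :: nat and E0 E1 E2 :: "cpoly3 \<times> cpoly3 \<times> cpoly3"
  assumes i_less: "i0 < d" "i1 < d" "i2 < d" and i_distinct: "i0 \<noteq> i1" "i0 \<noteq> i2" "i1 \<noteq> i2"
    and z_coeff: "coeff3 (l i0) 0 0 1 \<noteq> 0"
    and homt_E: "homt 0 E1" "homt 0 E2"
    and dual1: "der E1 (l i0) = 0" "der E1 (l i1) = 1" "der E1 (l i2) = 0"
    and dual2: "der E2 (l i0) = 0" "der E2 (l i1) = 0" "der E2 (l i2) = 1"
    and frame: "\<And>\<theta>. \<theta> = scale3 (der \<theta> (l i0)) E0 + scale3 (der \<theta> (l i1)) E1 + scale3 (der \<theta> (l i2)) E2"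
begin

section \<open>Coordinates of a syzygy\<close>

definition rest :: "nat set" where "rest = {..<d} - {i0, i1, i2}"

lemma card_rest: "card rest = d - 3"
proof -
  have "card rest = card {..<d} - card {i0, i1, i2}"
    unfolding rest_def by (rule card_Diff_subset) (use i_less in auto)
  then show ?thesis using i_distinct by simp
qed

text \<open>
  Subtracting the multiple \<open>c\<close> of the Euler derivation from \<open>\<theta>\<close> gives a derivation that kills
  \<open>l i0\<close> and maps \<open>l i1\<close>, \<open>l i2\<close> to \<open>a * l i1\<close>, \<open>b * l i2\<close>. The pairs arising in this way are exactly
  the admissible ones.
\<close>

definition admissible :: "cpoly3 \<Rightarrow> cpoly3 \<Rightarrow> bool"
  where "admissible a b \<longleftrightarrow> (\<forall>k\<in>rest. l k dvd a * l i1 * der E1 (l k) + b * l i2 * der E2 (l k))"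

definition has_coords :: "cpoly3 \<times> cpoly3 \<times> cpoly3 \<Rightarrow> cpoly3 \<Rightarrow> cpoly3 \<Rightarrow> bool"
  where "has_coords \<theta> a b \<longleftrightarrow> \<theta> \<in> AR f \<and>
    (\<exists>c. der \<theta> (l i0) = c * l i0 \<and> der \<theta> (l i1) = (c + a) * l i1 \<and> der \<theta> (l i2) = (c + b) * l i2)"

lemma ex_has_coords:
  assumes "\<theta> \<in> AR f"
  shows "\<exists>a b. has_coords \<theta> a b"
proof -
  have "\<exists>c. der \<theta> (l i) = c * l i" if "i < d" for i
    using AR_dvd[OF assms that] by (metis dvdE mult.commute)
  then obtain c0 c1 c2 where "der \<theta> (l i0) = c0 * l i0" "der \<theta> (l i1) = c1 * l i1" "der \<theta> (l i2) = c2 * l i2"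
    using i_less by meson
  then have "has_coords \<theta> (c1 - c0) (c2 - c0)"
    unfolding has_coords_def using assms by (intro conjI exI[of _ c0]) auto
  then show ?thesis by blast
qed

lemma has_coords_add:
  assumes "has_coords \<theta> a b" "has_coords \<theta>' a' b'"
  shows "has_coords (\<theta> + \<theta>') (a + a') (b + b')"
proof -
  obtain c c' where "der \<theta> (l i0) = c * l i0" "der \<theta> (l i1) = (c + a) * l i1" "der \<theta> (l i2) = (c + b) * l i2"
    "der \<theta>' (l i0) = c' * l i0" "der \<theta>' (l i1) = (c' + a') * l i1" "der \<theta>' (l i2) = (c' + b') * l i2"
    using assms unfolding has_coords_def by blast
  then show ?thesis
    using assms unfolding has_coords_def
    by (intro conjI exI[of _ "c + c'"]) (auto simp: AR_iff der_add algebra_simps)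
qed

lemma has_coords_scale:
  assumes "has_coords \<theta> a b"
  shows "has_coords (scale3 s \<theta>) (s * a) (s * b)"
proof -
  obtain c where "der \<theta> (l i0) = c * l i0" "der \<theta> (l i1) = (c + a) * l i1" "der \<theta> (l i2) = (c + b) * l i2"
    using assms unfolding has_coords_def by blast
  then show ?thesis
    using assms unfolding has_coords_def
    by (intro conjI exI[of _ "s * c"]) (auto simp: AR_iff der_scale algebra_simps)
qed

lemma has_coords_diff:
  assumes "has_coords \<theta> a b" "has_coords \<theta>' a' b'"
  shows "has_coords (\<theta> - \<theta>') (a - a') (b - b')"
proof -
  have "scale3 (- 1) \<theta>' = - \<theta>'" by (cases \<theta>') (simp add: scale3_def)
  then show ?thesis using has_coords_add[OF assms(1) has_coords_scale[OF assms(2), of "- 1"]] by simp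
qed

lemma has_coords_admissible:
  assumes "has_coords \<theta> a b"
  shows "admissible a b"
  unfolding admissible_def
proof
  fix k assume "k \<in> rest"
  then have k: "k < d" by (simp add: rest_def)
  obtain c where c: "der \<theta> (l i0) = c * l i0" "der \<theta> (l i1) = (c + a) * l i1" "der \<theta> (l i2) = (c + b) * l i2"
    using assms unfolding has_coords_def by blast
  \<comment> \<open>Now \<open>l i0\<close> is killed, so only \<open>E1\<close> and
    \<open>E2\<close> contribute to the frame expansion.\<close>
  define \<tau> where "\<tau> = \<theta> - scale3 c euler"
  have "der \<tau> (l i0) = 0" "der \<tau> (l i1) = a * l i1" "der \<tau> (l i2) = b * l i2"
    by (simp_all add: \<tau>_def der_diff der_scale der_euler_linear hom3_l i_less c algebra_simps)
  then have "der \<tau> (l k) = a * l i1 * der E1 (l k) + b * l i2 * der E2 (l k)"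
    by (subst frame) (simp add: der_add der_scale)
  moreover have "der \<tau> (l k) = der \<theta> (l k) - c * l k"
    by (simp add: \<tau>_def der_diff der_scale der_euler_linear hom3_l k)
  moreover have "l k dvd der \<theta> (l k)"
    using assms AR_dvd k unfolding has_coords_def by blast
  ultimately show "l k dvd a * l i1 * der E1 (l k) + b * l i2 * der E2 (l k)"
    by (metis dvd_diff dvd_triv_right)
qed

text \<open>Vanishing coordinates leave a multiple \<open>c\<close> of the Euler derivation, which
  multiplies \<open>f\<close> by \<open>c * d\<close>; it kills \<open>f\<close> only if
  \<open>c = 0\<close>.\<close>

lemma has_coords_0:
  assumes "has_coords \<theta> 0 0"
  shows "\<theta> = 0"
proof -
  obtain c where c: "der \<theta> (l i0) = c * l i0" "der \<theta> (l i1) = c * l i1" "der \<theta> (l i2) = c * l i2"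
    using assms unfolding has_coords_def by auto
  have "\<theta> = scale3 c euler"
    using frame[of \<theta>] frame[of "scale3 c euler"]
    by (simp add: der_scale c der_euler_linear hom3_l i_less)
  then have "c * (of_nat d * f) = 0"
    using assms by (simp add: has_coords_def AR_iff der_scale der_euler_f)
  then have "c = 0" using f_nonzero i_less by simp
  then show ?thesis using \<open>\<theta> = scale3 c euler\<close> by (simp add: scale3_def euler_def zero_prod_def)
qed

text \<open>The derivation \<open>\<tau>\<close> built from the frame multiplies every
  \<open>l i\<close> by some \<open>c i\<close>. Subtracting their average times the Euler
  derivation makes the eigenvalues sum to 0, hence kills \<open>f\<close>, and leaves the
  differences \<open>a\<close>, \<open>b\<close> intact.\<close>

lemma admissible_realized:
  assumes "admissible a b" "hom3 k a" "hom3 k b"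
  shows "\<exists>\<theta>. homt (k + 1) \<theta> \<and> has_coords \<theta> a b"
proof -
  define \<tau> where "\<tau> = scale3 (a * l i1) E1 + scale3 (b * l i2) E2"
  have \<tau>: "der \<tau> p = a * l i1 * der E1 p + b * l i2 * der E2 p" for p
    by (simp add: \<tau>_def der_add der_scale)
  have \<tau>_hom: "homt (k + 1) \<tau>"
    unfolding \<tau>_def
    using homt_add[OF homt_scale[OF hom3_mult[OF assms(2) hom3_l[OF i_less(2)]] homt_E(1)]
        homt_scale[OF hom3_mult[OF assms(3) hom3_l[OF i_less(3)]] homt_E(2)]]
    by simp
  have "\<exists>c. der \<tau> (l i) = c * l i" if i: "i < d" for i
  proof (cases "i \<in> rest")
    case True
    then show ?thesis using assms(1) unfolding admissible_def \<tau> by (metis dvdE mult.commute)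
  next
    case False
    then consider "i = i0" | "i = i1" | "i = i2" using i by (auto simp: rest_def)
    then show ?thesis by cases (auto simp: \<tau> dual1 dual2)
  qed
  then obtain c where c: "\<And>i. i < d \<Longrightarrow> der \<tau> (l i) = c i * l i" by metis
  have c_hom: "hom3 k (c i)" if "i < d" for i
    using hom3_cancel[of k 1 "c i" "l i"] hom3_der_linear[OF \<tau>_hom hom3_l[OF that]] hom3_l l_nonzero that
    by (simp add: c)
  have c012: "c i0 = 0" "c i1 = a" "c i2 = b"
    using c[of i0] c[of i1] c[of i2] i_less l_nonzero by (auto simp: \<tau> dual1 dual2)
  define K where "K = cst (1 / of_nat d) * (\<Sum>i<d. c i)"
  have K_hom: "hom3 k K"
    unfolding K_def using c_hom by (intro hom3_cmult hom3_sum) auto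
  define \<theta> where "\<theta> = \<tau> - scale3 K euler"
  have "homt (k + 1) \<theta>"
    unfolding \<theta>_def by (intro homt_diff \<tau>_hom homt_scale K_hom homt_euler)
  moreover have "has_coords \<theta> a b"
  proof -
    have "cst (1 / of_nat d) * of_nat d = 1"
      using i_less by (simp add: of_nat_poly one_pCons)
    then have "K * of_nat d = (\<Sum>i<d. c i)"
      unfolding K_def by (metis mult.assoc mult.commute mult_1_left)
    then have "der \<theta> f = 0"
      by (simp add: \<theta>_def der_diff der_scale der_euler_f der_f[OF c] flip: mult.assoc)
    moreover have "der \<theta> (l i) = (c i - K) * l i" if "i < d" for i
      using that by (simp add: \<theta>_def der_diff der_scale der_euler_linear hom3_l c algebra_simps)
    ultimately show ?thesis
      unfolding has_coords_def using i_less c012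
      by (intro conjI exI[of _ "- K"]) (auto simp: AR_iff)
  qed
  ultimately show ?thesis by blast
qed

lemma hom3_coords:
  assumes "has_coords \<theta> a b" "homt (k + 1) \<theta>"
  shows "hom3 k a" "hom3 k b"
proof -
  obtain c where c: "der \<theta> (l i0) = c * l i0" "der \<theta> (l i1) = (c + a) * l i1" "der \<theta> (l i2) = (c + b) * l i2"
    using assms unfolding has_coords_def by blast
  have *: "hom3 k e" if "der \<theta> (l i) = e * l i" "i < d" for e i
    using hom3_cancel[of k 1 e "l i"] hom3_der_linear[OF assms(2) hom3_l] hom3_l l_nonzero that by metis
  show "hom3 k a" "hom3 k b"
    using hom3_diff[OF *[OF c(2) i_less(2)] *[OF c(1) i_less(1)]]
      hom3_diff[OF *[OF c(3) i_less(3)] *[OF c(1) i_less(1)]] by simp_all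
qed

text \<open>Otherwise Euler's formula, expanded in the frame, would make \<open>l k\<close> a
  multiple of \<open>l i0\<close>.\<close>

lemma der_E_nonzero:
  assumes "k \<in> rest"
  shows "der E1 (l k) \<noteq> 0 \<or> der E2 (l k) \<noteq> 0"
proof (rule ccontr)
  assume "\<not> ?thesis"
  moreover have k: "k < d" "k \<noteq> i0" using assms by (auto simp: rest_def)
  have "l k = der euler (l k)" by (simp add: der_euler_linear hom3_l k)
  then have "l k = l i0 * der E0 (l k) + l i1 * der E1 (l k) + l i2 * der E2 (l k)"
    by (subst (asm) frame) (simp add: der_add der_scale der_euler_linear hom3_l i_less)
  ultimately have "l i0 dvd l k" by (metis add.right_neutral dvd_triv_left mult_zero_right)
  then show False using not_dvd k i_less by metis
qed

text \<open>Cramer's rule modulo \<open>l k\<close>: the determinant times \<open>l i1 * v\<close>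
  and times \<open>l i2 * w\<close> is divisible by \<open>l k\<close>. The lines differ, and the
  constants \<open>v\<close>, \<open>w\<close> are not both 0, so \<open>l k\<close> divides the
  determinant itself.\<close>

lemma admissible_det:
  assumes "admissible a b" "admissible a' b'"
  shows "(\<Prod>k\<in>rest. l k) dvd a * b' - a' * b"
proof (rule prod_primes_dvd)
  fix k assume k: "k \<in> rest"
  then have kd: "k < d" "k \<noteq> i1" "k \<noteq> i2" by (auto simp: rest_def)
  define v w where "v = der E1 (l k)" and "w = der E2 (l k)"
  have dvd: "l k dvd a * l i1 * v + b * l i2 * w" "l k dvd a' * l i1 * v + b' * l i2 * w"
    using assms k by (auto simp: admissible_def v_def w_def)
  have unit: "e dvd 1" if "e \<noteq> 0" "hom3 0 e" for e
  proof -
    have "e = cst (coeff3 e 0 0 0)" using hom3_0_eq that(2) by blast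
    moreover from this have "coeff3 e 0 0 0 \<noteq> 0" using that(1) by (metis pCons_0_0)
    ultimately show ?thesis by (metis cst_dvd_1 const_dvd_1)
  qed
  have "l k dvd (a * l i1 * v + b * l i2 * w) * b' - (a' * l i1 * v + b' * l i2 * w) * b"
    using dvd by (intro dvd_diff dvd_mult2)
  also have "\<dots> = l i1 * v * (a * b' - a' * b)" by (simp add: algebra_simps)
  finally have 1: "l k dvd v * (a * b' - a' * b)"
    using prime_elem_dvd_multD[OF prime_l[OF kd(1)]] not_dvd[OF kd(1) i_less(2) kd(2)]
    by (metis mult.assoc)
  have "l k dvd (a' * l i1 * v + b' * l i2 * w) * a - (a * l i1 * v + b * l i2 * w) * a'"
    using dvd by (intro dvd_diff dvd_mult2)
  also have "\<dots> = l i2 * w * (a * b' - a' * b)" by (simp add: algebra_simps)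
  finally have 2: "l k dvd w * (a * b' - a' * b)"
    using prime_elem_dvd_multD[OF prime_l[OF kd(1)]] not_dvd[OF kd(1) i_less(3) kd(3)]
    by (metis mult.assoc)
  have "hom3 0 v" "hom3 0 w"
    unfolding v_def w_def using hom3_der_linear homt_E hom3_l kd by blast+
  then have "v dvd 1 \<or> w dvd 1"
    using der_E_nonzero[OF k] unit unfolding v_def w_def by blast
  then show "l k dvd a * b' - a' * b"
    using 1 2 dvd_mult_unit_iff' by blast
next
  show "prime_elem (l k)" if "k \<in> rest" for k using that by (simp add: rest_def prime_l)
  show "\<not> l k dvd l j" if "k \<in> rest" "j \<in> rest" "k \<noteq> j" for k j
    using that by (simp add: rest_def not_dvd)
qed (simp add: rest_def)

text \<open>The line \<open>l i0 = 0\<close> has the equation \<open>z = lam\<close>, so \<open>\<lambda>p. poly p lam\<close> is restriction to it.\<close>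

definition lam :: "complex poly poly"
  where "lam = - ([:[:1 / coeff3 (l i0) 0 0 1:]:] * [:[:0, coeff3 (l i0) 1 0 0:], [:coeff3 (l i0) 0 1 0:]:])"

lemma hom2_lam: "hom2 1 lam"
  by (auto simp: lam_def hom2_iff coeff_pCons split: nat.splits)

lemma poly_lam_eq_0_iff: "poly p lam = 0 \<longleftrightarrow> l i0 dvd p"
proof -
  have "[:[:coeff3 (l i0) 0 0 1:]:] * [:[:1 / coeff3 (l i0) 0 0 1:]:] = 1"
    using z_coeff by (simp add: one_pCons)
  from dvd_linear_iff[OF this, of "[:[:0, coeff3 (l i0) 1 0 0:], [:coeff3 (l i0) 0 1 0:]:]" p]
  show ?thesis using hom3_1_eq[OF hom3_l[OF i_less(1)]] by (simp add: lam_def)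
qed

text \<open>For \<open>M = AR f\<close> this is the module \<open>N\<close> of the overview.
  Coordinates are quotients by linear forms, so their degree is one below that of the
  syzygy.\<close>

definition restricted :: "(cpoly3 \<times> cpoly3 \<times> cpoly3) set \<Rightarrow> int \<Rightarrow> (complex poly poly \<times> complex poly poly) set"
  where "restricted M k =
    {(poly a lam, poly b lam) | a b. \<exists>\<theta>\<in>M. homt (k + 1) \<theta> \<and> has_coords \<theta> a b}"

lemma restrictedI:
  "\<theta> \<in> M \<Longrightarrow> homt (k + 1) \<theta> \<Longrightarrow> has_coords \<theta> a b \<Longrightarrow> (poly a lam, poly b lam) \<in> restricted M k"
  unfolding restricted_def by blast

lemma gsub_restricted:
  assumes "S3.subspace M"
  shows "gsub (restricted M)"
  unfolding gsub_def
proof (intro conjI allI impI)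
  fix k x y assume "x \<in> restricted M k" "y \<in> restricted M k"
  then obtain \<theta> a b \<theta>' a' b' where "x = (poly a lam, poly b lam)" "\<theta> \<in> M" "homt (k + 1) \<theta>" "has_coords \<theta> a b"
    "y = (poly a' lam, poly b' lam)" "\<theta>' \<in> M" "homt (k + 1) \<theta>'" "has_coords \<theta>' a' b'"
    unfolding restricted_def by blast
  then show "x + y \<in> restricted M k"
    using restrictedI[OF S3.subspace_add[OF assms] homt_add has_coords_add, of \<theta> \<theta>' k a b a' b'] by simp
next
  fix k m r x assume "x \<in> restricted M k" and r: "hom2 m r"
  then obtain \<theta> a b where x: "x = (poly a lam, poly b lam)" and \<theta>: "\<theta> \<in> M" "homt (k + 1) \<theta>" "has_coords \<theta> a b"
    unfolding restricted_def by blast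
  \<comment> \<open>A binary form is lifted to three variables as a polynomial constant in z, which
    restriction does not change.\<close>
  have "scale3 [:r:] \<theta> \<in> M" "homt (k + m + 1) (scale3 [:r:] \<theta>)"
    using S3.subspace_scale[OF assms \<theta>(1)] homt_scale[of m "[:r:]", OF _ \<theta>(2)] r
    by (simp_all add: hom2_def algebra_simps)
  moreover have "r * fst x = poly ([:r:] * a) lam" "r * snd x = poly ([:r:] * b) lam"
    by (simp_all add: x)
  ultimately show "(r * fst x, r * snd x) \<in> restricted M (k + m)"
    unfolding restricted_def using has_coords_scale[OF \<theta>(3), of "[:r:]"] by blast
qed

text \<open>Graded Nakayama: a syzygy whose coordinates vanish on the line \<open>l i0 = 0\<close> is \<open>l i0\<close> times a syzygy.\<close>

lemma AR_generated_by_restricted: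
  assumes sub: "S3.subspace M"
    and cover: "\<And>k. restricted (AR f) k \<subseteq> restricted M k"
  shows "AR f \<subseteq> M"
proof -
  have hom: "\<theta> \<in> M" if "\<theta> \<in> AR f" "homt (int n) \<theta>" for n \<theta>
    using that
  proof (induction n arbitrary: \<theta> rule: less_induct)
    case (less n)
    define k where "k = int n - 1"
    obtain a b where ab: "has_coords \<theta> a b" using ex_has_coords less.prems by blast
    then have "(poly a lam, poly b lam) \<in> restricted (AR f) k"
      using less.prems unfolding restricted_def k_def by auto
    then obtain \<theta>' a' b' where \<theta>': "\<theta>' \<in> M" "homt (k + 1) \<theta>'" "has_coords \<theta>' a' b'"
      and eq: "poly a lam = poly a' lam" "poly b lam = poly b' lam"
      using cover[of k] unfolding restricted_def by blast
    note diff = has_coords_diff[OF ab \<theta>'(3)]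
    have "poly (a - a') lam = 0" "poly (b - b') lam = 0" using eq by simp_all
    then obtain a2 b2 where a2: "a - a' = a2 * l i0" "b - b' = b2 * l i0"
      unfolding poly_lam_eq_0_iff by (metis dvdE mult.commute)
    have "homt (k + 1) (\<theta> - \<theta>')" using less.prems \<theta>' by (intro homt_diff) (auto simp: k_def)
    from hom3_coords[OF diff this] have "hom3 (k - 1) a2" "hom3 (k - 1) b2"
      using hom3_cancel[of "k - 1" 1 _ "l i0"] hom3_l l_nonzero i_less by (auto simp: a2)
    \<comment> \<open>\<open>l j\<close> is prime and does not divide \<open>l i0\<close>, so the
      divisibility conditions survive division by \<open>l i0\<close>.\<close>
    moreover have "admissible a2 b2"
      unfolding admissible_def
    proof
      fix j assume j: "j \<in> rest"
      then have "l j dvd a2 * l i0 * l i1 * der E1 (l j) + b2 * l i0 * l i2 * der E2 (l j)"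
        using has_coords_admissible[OF diff] unfolding admissible_def a2 by blast
      then have "l j dvd l i0 * (a2 * l i1 * der E1 (l j) + b2 * l i2 * der E2 (l j))"
        by (simp add: algebra_simps)
      moreover have "j < d" "j \<noteq> i0" using j by (auto simp: rest_def)
      ultimately show "l j dvd a2 * l i1 * der E1 (l j) + b2 * l i2 * der E2 (l j)"
        using prime_elem_dvd_multD[OF prime_l] not_dvd i_less by metis
    qed
    ultimately obtain \<eta> where \<eta>: "homt k \<eta>" "has_coords \<eta> a2 b2"
      using admissible_realized[of a2 b2 "k - 1"] by auto
    have "has_coords (\<theta> - \<theta>' - scale3 (l i0) \<eta>) 0 0"
      using has_coords_diff[OF diff has_coords_scale[OF \<eta>(2), of "l i0"]] by (simp add: a2 mult.commute)
    then have "\<theta> - \<theta>' - scale3 (l i0) \<eta> = 0" by (rule has_coords_0)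
    then have \<theta>: "\<theta> = \<theta>' + scale3 (l i0) \<eta>" by (simp add: algebra_simps)
    have "\<eta> \<in> M"
    proof (cases n)
      case 0
      \<comment> \<open>Here \<open>\<eta>\<close> has degree -1.\<close>
      then have "\<eta> = 0" using homt_neg[OF _ \<eta>(1)] by (simp add: k_def)
      then show ?thesis using S3.subspace_0[OF sub] by simp
    next
      case (Suc n')
      then show ?thesis
        using less.IH[of n' \<eta>] \<eta> by (simp add: k_def has_coords_def)
    qed
    then show ?case unfolding \<theta> using \<theta>'(1) S3.subspace_add[OF sub] S3.subspace_scale[OF sub] by blast
  qed
  show ?thesis
  proof
    fix \<theta> assume \<theta>: "\<theta> \<in> AR f"
    obtain m where m: "\<theta> = (\<Sum>r\<le>m. partt (int r) \<theta>)" using sum_partt by blast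
    have "hom3 (int d) f" using hom3_prod[of "{..<d}"] by (simp add: f_def)
    then have "partt (int r) \<theta> \<in> M" for r
      using hom partt_AR[OF \<theta>] homt_partt by blast
    then show "\<theta> \<in> M" using S3.subspace_sum[OF sub] m by metis
  qed
qed

text \<open>Generators of the restricted module modulo \<open>h\<close> are lifted to syzygies. Two
  syzygies with coordinates \<open>(H, 0)\<close> and \<open>(0, H)\<close> cover the multiples of
  \<open>h\<close>, and graded Nakayama transfers generation back to \<open>AR f\<close>.\<close>

lemma AR_generators:
  "\<exists>G. finite G \<and> card G \<le> d - 1 \<and> (\<forall>g\<in>G. \<exists>n. homogeneous_triple n g) \<and> S3.span G = AR f"
proof -
  define hs where "hs = map (\<lambda>k. poly (l k) lam) (sorted_list_of_set rest)"
  define h where "h = prod_list hs"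
  define H where "H = (\<Prod>k\<in>rest. l k)"
  have fin_rest: "finite rest" by (simp add: rest_def)
  have len: "length hs = d - 3" by (simp add: hs_def card_rest)
  have h_eq: "h = poly H lam"
    using prod.distinct_set_conv_list[of "sorted_list_of_set rest" "\<lambda>k. poly (l k) lam"] fin_rest
    by (simp add: h_def hs_def H_def poly_prod)
  have hs: "hom2 1 g \<and> g \<noteq> 0" if g: "g \<in> set hs" for g
  proof -
    obtain k where k: "g = poly (l k) lam" "k \<in> rest" using g fin_rest by (auto simp: hs_def)
    then have "k < d" "k \<noteq> i0" by (auto simp: rest_def)
    then show ?thesis
      using k(1) hom2_poly[OF hom3_l hom2_lam] not_dvd[of i0 k] i_less poly_lam_eq_0_iff by metis
  qed
  obtain G where gen: "generates_mod (d - 3) 0 0 h (restricted (AR f)) G"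
  proof -
    have "\<exists>G. generates_mod (length hs) 0 0 (prod_list hs) (restricted (AR f)) G"
    proof (rule generates_mod_of_dets[OF gsub_restricted[OF AR_subspace] _ hs])
      fix k x y assume "(x, y) \<in> restricted (AR f) k"
      then show "hom2 (k + 0) x \<and> hom2 (k + 0) y"
        using hom3_coords hom2_poly[OF _ hom2_lam] unfolding restricted_def by auto
    next
      fix k k' x y x' y' assume "(x, y) \<in> restricted (AR f) k" "(x', y') \<in> restricted (AR f) k'"
      then obtain a b a' b' where "x = poly a lam" "y = poly b lam" "x' = poly a' lam" "y' = poly b' lam"
        and "admissible a b" "admissible a' b'"
        using has_coords_admissible unfolding restricted_def by blast
      moreover from this have "poly (a * b' - a' * b) lam = x * y' - x' * y" by simp
      moreover obtain e where "a * b' - a' * b = H * e"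
        using admissible_det \<open>admissible a b\<close> \<open>admissible a' b'\<close> unfolding H_def by (meson dvdE)
      ultimately have "x * y' - x' * y = h * poly e lam" by (metis h_eq poly_mult)
      then show "prod_list hs dvd x * y' - x' * y" by (simp add: h_def)
    qed
    then show thesis using that len by (auto simp: h_def)
  qed
  note G = generates_modD[OF gen]
  have "\<exists>\<theta>. \<theta> \<in> AR f \<and> homt (fst g + 1) \<theta> \<and>
      (\<exists>a b. has_coords \<theta> a b \<and> snd g = (poly a lam, poly b lam))" if "g \<in> G" for g
  proof -
    have "snd g \<in> restricted (AR f) (fst g)" using G(3) that by simp
    then show ?thesis unfolding restricted_def by blast
  qed
  then obtain F where F: "\<And>g. g \<in> G \<Longrightarrow> F g \<in> AR f \<and> homt (fst g + 1) (F g) \<and>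
      (\<exists>a b. has_coords (F g) a b \<and> snd g = (poly a lam, poly b lam))"
    by metis
  have H_hom: "hom3 (int (d - 3)) H"
    using hom3_prod[of rest] unfolding H_def card_rest by (auto simp: rest_def)
  have H_dvd: "l k dvd H" if "k \<in> rest" for k
    using that fin_rest by (auto simp: H_def)
  have "admissible H 0" "admissible 0 H"
    using H_dvd by (auto simp: admissible_def intro: dvd_mult2)
  \<comment> \<open>Together with the \<open>d - 3\<close> generators modulo \<open>h\<close>, these two give \<open>d - 1\<close>.\<close>
  then obtain \<theta>1 \<theta>2 where \<theta>1: "homt (int (d - 3) + 1) \<theta>1" "has_coords \<theta>1 H 0"
    and \<theta>2: "homt (int (d - 3) + 1) \<theta>2" "has_coords \<theta>2 0 H"
    using admissible_realized[of H 0] admissible_realized[of 0 H] H_hom hom3_0 by blast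
  define \<Theta> where "\<Theta> = F ` G \<union> {\<theta>1, \<theta>2}"
  have "finite \<Theta>" using G(1) by (simp add: \<Theta>_def)
  moreover have "card \<Theta> \<le> d - 1"
  proof -
    \<comment> \<open>\<open>3 \<le> d\<close> turns \<open>d - 3 + 2\<close> into
      \<open>d - 1\<close> despite truncated subtraction.\<close>
    have "card {i0, i1, i2} \<le> card {..<d}" by (rule card_mono) (use i_less in auto)
    then have "3 \<le> d" using i_distinct by simp
    moreover have "card \<Theta> \<le> card (F ` G) + card {\<theta>1, \<theta>2}" unfolding \<Theta>_def by (rule card_Un_le)
    moreover have "card (F ` G) \<le> d - 3" using card_image_le[OF G(1)] G(2) le_trans by blast
    moreover have "card {\<theta>1, \<theta>2} \<le> 2" by (simp add: card_insert_if)
    ultimately show ?thesis by linarith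
  qed
  moreover have "\<forall>g\<in>\<Theta>. \<exists>n. homogeneous_triple n g"
    using F \<theta>1 \<theta>2 homogeneous_triple_of_homt unfolding \<Theta>_def by blast
  moreover have "S3.span \<Theta> \<subseteq> AR f"
    using F \<theta>1 \<theta>2 by (intro S3.span_minimal AR_subspace) (auto simp: \<Theta>_def has_coords_def)
  moreover have "AR f \<subseteq> S3.span \<Theta>"
  proof (rule AR_generated_by_restricted)
    show "S3.subspace (S3.span \<Theta>)" by (rule S3.subspace_span)
    show "restricted (AR f) k \<subseteq> restricted (S3.span \<Theta>) k" for k
    proof (rule generates_mod_subset[OF gen gsub_restricted[OF S3.subspace_span]])
      fix k x assume "(k, x) \<in> G"
      moreover from this have "F (k, x) \<in> S3.span \<Theta>" by (intro S3.span_base) (simp add: \<Theta>_def)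
      ultimately show "x \<in> restricted (S3.span \<Theta>) k"
        using F[of "(k, x)"] unfolding restricted_def by auto
    next
      fix k p q assume "hom2 (k + 0 - int (d - 3)) p" "hom2 (k + 0 - int (d - 3)) q"
      then have pq: "hom3 (k - int (d - 3)) [:p:]" "hom3 (k - int (d - 3)) [:q:]" by (simp_all add: hom2_def)
      \<comment> \<open>Its coordinates \<open>[:p:] * H\<close> and \<open>[:q:] * H\<close>
        restrict to the prescribed multiples of \<open>h\<close>.\<close>
      define \<theta> where "\<theta> = scale3 [:p:] \<theta>1 + scale3 [:q:] \<theta>2"
      have "\<theta> \<in> S3.span \<Theta>"
        unfolding \<theta>_def by (intro S3.span_add S3.span_scale S3.span_base) (auto simp: \<Theta>_def)
      moreover have "homt (k + 1) \<theta>"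
        using homt_add[OF homt_scale[OF pq(1) \<theta>1(1)] homt_scale[OF pq(2) \<theta>2(1)]]
        by (simp add: \<theta>_def algebra_simps)
      moreover have "has_coords \<theta> ([:p:] * H) ([:q:] * H)"
        using has_coords_add[OF has_coords_scale[OF \<theta>1(2), of "[:p:]"] has_coords_scale[OF \<theta>2(2), of "[:q:]"]]
        by (simp add: \<theta>_def)
      moreover have "(h * p, h * q) = (poly ([:p:] * H) lam, poly ([:q:] * H) lam)"
        by (simp add: h_eq mult.commute)
      ultimately show "(h * p, h * q) \<in> restricted (S3.span \<Theta>) k"
        unfolding restricted_def by blast
    qed
  qed
  ultimately show ?thesis by blast
qed

end

text \<open>Non-concurrency is used twice: at \<open>(0, 0, 1)\<close> it yields a line
  \<open>i0\<close> whose equation involves z, and at the intersection of the lines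
  \<open>i0\<close> and \<open>i1\<close> it yields a third line \<open>i2\<close> missing that
  point.\<close>

lemma (in line_arrangement) framed_arrangementI:
  assumes d: "d \<ge> 3" and conc: "\<not> (\<exists>P. P \<noteq> (0, 0, 0) \<and> (\<forall>i<d. eval3 (l i) P = 0))"
  shows "\<exists>i0 i1 i2 E0 E1 E2. framed_arrangement d l i0 i1 i2 E0 E1 E2"
proof -
  define p q r where "p i = coeff3 (l i) 1 0 0" and "q i = coeff3 (l i) 0 1 0" and "r i = coeff3 (l i) 0 0 1" for i
  have ev: "eval3 (l i) (u, v, w) = p i * u + q i * v + r i * w" if "i < d" for i u v w
    using eval3_linear[OF hom3_l[OF that]] by (simp add: p_def q_def r_def)
  have l_eq: "l i = [:[:[:0, p i:], [:q i:]:], [:[:r i:]:]:]" if "i < d" for i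
    using hom3_1_eq[OF hom3_l[OF that]] by (simp add: p_def q_def r_def)
  have "(0, 0, 1) \<noteq> (0, 0, 0 :: complex)" by simp
  then obtain i0 where "i0 < d" "eval3 (l i0) (0, 0, 1) \<noteq> 0" using conc by blast
  then have i0: "i0 < d" "r i0 \<noteq> 0" by (simp_all add: ev)
  obtain i1 where i1: "i1 < d" "i1 \<noteq> i0"
    by (rule that[of "if i0 = 0 then 1 else 0"]) (use d in auto)
  \<comment> \<open>The cross product of the coefficient vectors is the intersection point of the
    two lines; it is nonzero since they are distinct.\<close>
  define u v w where "u = q i0 * r i1 - q i1 * r i0" and "v = r i0 * p i1 - r i1 * p i0"
    and "w = p i0 * q i1 - p i1 * q i0"
  have "(u, v, w) \<noteq> (0, 0, 0)"
  proof
    assume "(u, v, w) = (0, 0, 0)"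
    then have uv: "q i1 * r i0 = q i0 * r i1" "p i1 * r i0 = r i1 * p i0"
      by (simp_all add: u_def v_def algebra_simps)
    define c where "c = r i1 / r i0"
    have c: "p i1 = c * p i0" "q i1 = c * q i0" "r i1 = c * r i0"
      using uv i0(2) by (simp_all add: c_def field_simps)
    have "l i1 = cst c * l i0"
      by (simp add: l_eq i1(1) i0(1) c)
    moreover from this have "c \<noteq> 0" using l_nonzero[OF i1(1)] by auto
    ultimately show False using distinct[OF i1(1) i0(1) i1(2)] unfolding proportional_def by blast
  qed
  then obtain i2 where i2: "i2 < d" "eval3 (l i2) (u, v, w) \<noteq> 0" using conc by blast
  have "eval3 (l i0) (u, v, w) = 0" "eval3 (l i1) (u, v, w) = 0"
    using ev i0 i1 by (simp_all add: u_def v_def w_def algebra_simps)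
  then have ne: "i2 \<noteq> i0" "i2 \<noteq> i1" using i2 by auto
  have "p i2 * (q i0 * r i1 - q i1 * r i0) + q i2 * (r i0 * p i1 - r i1 * p i0) + r i2 * (p i0 * q i1 - p i1 * q i0) \<noteq> 0"
    using i2 ev by (simp add: u_def v_def w_def)
  then obtain x0 y0 z0 x1 y1 z1 x2 y2 z2 where dual:
    "p i0 * x1 + q i0 * y1 + r i0 * z1 = 0" "p i1 * x1 + q i1 * y1 + r i1 * z1 = 1" "p i2 * x1 + q i2 * y1 + r i2 * z1 = 0"
    "p i0 * x2 + q i0 * y2 + r i0 * z2 = 0" "p i1 * x2 + q i1 * y2 + r i1 * z2 = 0" "p i2 * x2 + q i2 * y2 + r i2 * z2 = 1"
    and inv: "p i0 * x0 + p i1 * x1 + p i2 * x2 = 1" "q i0 * x0 + q i1 * x1 + q i2 * x2 = 0" "r i0 * x0 + r i1 * x1 + r i2 * x2 = 0"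
    "p i0 * y0 + p i1 * y1 + p i2 * y2 = 0" "q i0 * y0 + q i1 * y1 + q i2 * y2 = 1" "r i0 * y0 + r i1 * y1 + r i2 * y2 = 0"
    "p i0 * z0 + p i1 * z1 + p i2 * z2 = 0" "q i0 * z0 + q i1 * z1 + q i2 * z2 = 0" "r i0 * z0 + r i1 * z1 + r i2 * z2 = 1"
    by (rule dual_frame)
  define E where "E x y z = (cst x, cst y, cst z)" for x y z
  have der: "der (a, b, c) (l i) = a * cst (p i) + b * cst (q i) + c * cst (r i)" if "i < d" for a b c i
    using der_linear[OF hom3_l[OF that]] by (simp add: p_def q_def r_def)
  have der_E: "der (E x y z) (l i) = cst (p i * x + q i * y + r i * z)" if "i < d" for x y z i
    using der[OF that] by (simp add: E_def algebra_simps)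
  have cst_sum: "cst a * cst a' + cst b * cst b' + cst c * cst c' = cst (a * a' + b * b' + c * c')" for a b c a' b' c'
    by simp
  have frame: "\<theta> = scale3 (der \<theta> (l i0)) (E x0 y0 z0) + scale3 (der \<theta> (l i1)) (E x1 y1 z1) + scale3 (der \<theta> (l i2)) (E x2 y2 z2)" for \<theta>
  proof -
    obtain a b c where \<theta>: "\<theta> = (a, b, c)" by (cases \<theta>)
    \<comment> \<open>Regrouping by the components of \<open>\<theta>\<close> exposes the entries of
      the inverse matrix times the matrix, which \<open>inv\<close> evaluates.\<close>
    have comb: "(a * P0 + b * Q0 + c * R0) * X0 + (a * P1 + b * Q1 + c * R1) * X1 + (a * P2 + b * Q2 + c * R2) * X2 =
      a * (P0 * X0 + P1 * X1 + P2 * X2) + b * (Q0 * X0 + Q1 * X1 + Q2 * X2) + c * (R0 * X0 + R1 * X1 + R2 * X2)"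
      for P0 P1 P2 Q0 Q1 Q2 R0 R1 R2 X0 X1 X2 :: cpoly3
      by (simp add: algebra_simps)
    show ?thesis
      unfolding \<theta> der[OF i0(1)] der[OF i1(1)] der[OF i2(1)] E_def scale3_def split_conv add_Pair comb cst_sum inv
      by (simp flip: one_pCons)
  qed
  have "framed_arrangement d l i0 i1 i2 (E x0 y0 z0) (E x1 y1 z1) (E x2 y2 z2)"
  proof unfold_locales
    show "coeff3 (l i0) 0 0 1 \<noteq> 0" using i0 by (simp add: r_def)
    show "homt 0 (E x1 y1 z1)" "homt 0 (E x2 y2 z2)"
      by (simp_all add: homt_def E_def hom3_const)
  qed (use i0 i1 i2 ne frame in \<open>auto simp: der_E dual one_pCons\<close>)
  then show ?thesis by blast
qed

theorem corollary1p3: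
  fixes d :: nat and l :: "nat \<Rightarrow> cpoly3" and f :: cpoly3
  assumes "d \<ge> 3"
    and "\<And>i. i < d \<Longrightarrow> linear_form (l i)"
    and "\<And>i j. i < d \<Longrightarrow> j < d \<Longrightarrow> i \<noteq> j \<Longrightarrow> \<not> proportional (l i) (l j)"
    and "f = (\<Prod>i<d. l i)"
    and "\<not> (\<exists>P. P \<noteq> (0, 0, 0) \<and> (\<forall>i<d. eval3 (l i) P = 0))"
  shows "\<exists>G. finite G \<and> card G \<le> d - 1 \<and> (\<forall>g\<in>G. \<exists>n. homogeneous_triple n g)
           \<and> S3.span G = AR f"
proof -
  interpret line_arrangement d l by unfold_locales (use assms in auto)
  obtain i0 i1 i2 E0 E1 E2 where "framed_arrangement d l i0 i1 i2 E0 E1 E2"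
    using framed_arrangementI assms(1,5) by blast
  then interpret framed_arrangement d l i0 i1 i2 E0 E1 E2 .
  show ?thesis using AR_generators assms(4) by (simp add: f_def)
qed

end
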